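(* Let $\mathcal G$ be a time-invariant communication graph on $N$ nodes with adjacency matrix $A=(a_{kj})$ and Laplacian $L$, and let $\phi:\mathbb R^d\to\mathbb R$ be globally Lipschitz. Suppose that: (1) the graph $\mathcal G$ is connected; (2) there exists a nonempty compact set $W\subset\mathbb R^d$, invariant for $\dot w=Sw+B\phi(w)$, such that the system $\dot w = Sw+B\phi(w)+v$ is input-to-state stable with respect to $v$ relative to $W$. Let $\mu>0$ be such that $\mathrm{Re}[\lambda_i(L)]\ge\mu$ for $i=2,\dots,N$, let $a>0$, let $P$ be the unique positive definite symmetric solution of the algebraic Riccati equation $$SP+PS^T-2\mu PC^TCP+aI=0,$$ and set $K_0=PC^T$. For $g>0$ let $D_g=\mathrm{diag}(g,g^2,\dots,g^d)$ and consider the network of $N$ coupled systems $$\dot w_k=Sw_k+B\phi(w_k)+D_gK_0\sum_{j=1}^N a_{kj}(Cw_j-Cw_k),\qquad k=1,\dots,N,$$ with $w_k\in\mathbb R^d$. Then there is a number $g^\ast>0$ such that, if $g\ge g^\ast$, the states of the $N$ systems reach consensus, i.e. for every choice of initial conditions $w_k(0)\in\mathbb R^d$, $k=1,\dots,N$, there is a function $w^\ast:\mathbb R\to\mathbb R^d$ such that $$\lim_{t\to\infty}|w_k(t)-w^\ast(t)|=0\qquad\text{for all }k=1,\dots,N.$$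
   Context: Communication graph: a triplet $\mathcal G=\{\mathcal V,\mathcal E,A\}$ with vertices $\mathcal V=\{v_1,\dots,v_N\}$, edges $\mathcal E\subset\mathcal V\times\mathcal V$, where $(v_k,v_j)\in\mathcal E$ means that information flows from node $j$ to node $k$, and adjacency matrix $A=(a_{kj})\in\mathbb R^{N\times N}$ with constant nonnegative entries, $a_{kj}$ weighting the flow from node $j$ to node $k$ (so $a_{kj}\neq0$ exactly when $(v_k,v_j)\in\mathcal E$). There are no self-loops: $(v_k,v_k)\notin\mathcal E$. A path from $v_j$ to $v_k$ is a sequence of distinct nodes $v_{\ell_1},\dots,v_{\ell_r}$ with $v_{\ell_1}=v_j$, $v_{\ell_r}=v_k$ and $(v_{\ell_{i+1}},v_{\ell_i})\in\mathcal E$ for each $i$. The graph is connected if there is a node $v$ such that for every other node $v_k\in\mathcal V\setminus\{v\}$ there is a path from $v$ to $v_k$. Laplacian: $L=(\ell_{kj})$ with $\ell_{kj}=-a_{kj}$ for $k\ne j$ and $\ell_{kk}=\sum_{i=1}^N a_{ki}$. The vector $1_N$ of all ones is an eigenvector of $L$ for the eigenvalue $0$; the other $N-1$ eigenvalues are denoted $\lambda_2(L),\dots,\lambda_N(L)$. The graph is connected if and only if these all have positive real part, so a $\mu$ as in the claim exists. Prime form: $(S,B,C)$ is the triplet with $S\in\mathbb R^{d\times d}$ having ones on the first superdiagonal and zeros elsewhere, $B=(0,\dots,0,1)^T\in\mathbb R^{d\times1}$ and $C=(1,0,\dots,0)\in\mathbb R^{1\times d}$. Input-to-state stability relative to $W$: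 writing $\|w\|_W$ for the distance of $w$ from $W$ and $w(t,\bar w)$ for the solution of $\dot w=Sw+B\phi(w)+v$ with initial condition $\bar w$ and input $v(\cdot)$, there exist a class-$\mathcal{KL}$ function $\beta$ and a class-$\mathcal K$ function $\gamma$ such that $\|w(t,\bar w)\|_W\le\max\{\beta(\|\bar w\|_W,t),\ \gamma(\sup_{\tau\in[0,t)}\|v(\tau)\|)\}$ for all $\bar w\in\mathbb R^d$, all inputs $v$ and all $t\ge0$. *)

theory Defs
  imports "HOL-Analysis.Analysis" "HOL-Computational_Algebra.Computational_Algebra"
begin

text \<open>Communication graphs on the vertex set \<open>UNIV :: 'n set\<close>. Both \<open>(k, j) \<in> E\<close> and
  \<open>A $ k $ j\<close> refer to information flowing from \<open>j\<close> to \<open>k\<close>.\<close>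

definition communication_graph :: "('n::finite \<times> 'n) set \<Rightarrow> real^'n^'n \<Rightarrow> bool" where
  "communication_graph E A \<longleftrightarrow>
     (\<forall>k j. A $ k $ j \<ge> 0) \<and>
     (\<forall>k j. A $ k $ j \<noteq> 0 \<longleftrightarrow> (k, j) \<in> E) \<and>
     (\<forall>k. (k, k) \<notin> E)"

definition graph_path :: "('n \<times> 'n) set \<Rightarrow> 'n \<Rightarrow> 'n \<Rightarrow> 'n list \<Rightarrow> bool" where
  "graph_path E j k p \<longleftrightarrow>
     p \<noteq> [] \<and> distinct p \<and> hd p = j \<and> last p = k \<and>
     (\<forall>i. Suc i < length p \<longrightarrow> (p ! Suc i, p ! i) \<in> E)"

definition graph_connected :: "('n \<times> 'n) set \<Rightarrow> bool" where
  "graph_connected E \<longleftrightarrow> (\<exists>v. \<forall>k. k \<noteq> v \<longrightarrow> (\<exists>p. graph_path E v k p))"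

definition laplacian :: "real^'n^'n \<Rightarrow> real^'n^'n::finite" where
  "laplacian A = (\<chi> k j. if k = j then (\<Sum>i\<in>UNIV. A $ k $ i) else - (A $ k $ j))"

definition charpoly :: "complex^'n^'n \<Rightarrow> complex poly" where
  "charpoly M = det (\<chi> i j. (if i = j then [:0, 1:] else 0) - [:M $ i $ j:])"

text \<open>Eigenvalues over the complex numbers, counted with algebraic multiplicity.\<close>

definition eigenvalues :: "real^'n^'n \<Rightarrow> complex multiset" where
  "eigenvalues M = proots (charpoly (\<chi> i j. complex_of_real (M $ i $ j)))"

text \<open>The multiset of the eigenvalues \<open>\<lambda>\<^sub>2(L), \<dots>, \<lambda>\<^sub>N(L)\<close>: a single occurrence of \<open>0\<close> (the one
  belonging to the all-ones vector) is removed; further occurrences are kept.\<close>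

definition other_eigenvalues :: "real^'n^'n \<Rightarrow> complex multiset" where
  "other_eigenvalues L = eigenvalues L - {#0#}"

text \<open>Coordinates of \<open>\<real>\<^sup>d\<close> are indexed by a finite linearly ordered type with \<open>d\<close> elements;
  \<open>idx\<close> is its order isomorphism onto \<open>{1..d}\<close>.\<close>

definition idx :: "'d::{finite,linorder} \<Rightarrow> nat" where
  "idx i = card {..i}"

definition prime_S :: "real^'d::{finite,linorder}^'d::{finite,linorder}" where
  "prime_S = (\<chi> i j. if idx j = idx i + 1 then 1 else 0)"

definition prime_B :: "real^1^'d::{finite,linorder}" where
  "prime_B = (\<chi> i _. if idx i = CARD('d) then 1 else 0)"

definition prime_C :: "real^'d::{finite,linorder}^1" where
  "prime_C = (\<chi> _ j. if idx j = 1 then 1 else 0)"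

definition gain_D :: "real \<Rightarrow> real^'d::{finite,linorder}^'d::{finite,linorder}" where
  "gain_D g = (\<chi> i j. if i = j then g ^ idx i else 0)"

definition drift ::
    "(real^'d::{finite,linorder} \<Rightarrow> real) \<Rightarrow> real^'d::{finite,linorder} \<Rightarrow> real^'d::{finite,linorder}" where
  "drift \<phi> w = prime_S *v w + prime_B *v vec (\<phi> w)"

definition class_K :: "(real \<Rightarrow> real) \<Rightarrow> bool" where
  "class_K \<gamma> \<longleftrightarrow> continuous_on {0..} \<gamma> \<and> strict_mono_on {0..} \<gamma> \<and> \<gamma> 0 = 0"

definition class_KL :: "(real \<Rightarrow> real \<Rightarrow> real) \<Rightarrow> bool" where
  "class_KL \<beta> \<longleftrightarrow>
     continuous_on ({0..} \<times> {0..}) (\<lambda>(r, t). \<beta> r t) \<and>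
     (\<forall>t\<ge>0. class_K (\<lambda>r. \<beta> r t)) \<and>
     (\<forall>r\<ge>0. antimono_on {0..} (\<beta> r) \<and> (\<beta> r \<longlongrightarrow> 0) at_top)"

text \<open>Inputs are the measurable, locally bounded functions on \<open>[0, \<infinity>)\<close>. As they may be
  discontinuous, solutions are meant in the sense of Caratheodory, i.e. as solutions of the
  integral equation.\<close>

definition admissible_input :: "(real \<Rightarrow> real^'d) \<Rightarrow> bool" where
  "admissible_input v \<longleftrightarrow>
     v \<in> borel_measurable (lebesgue_on {0..}) \<and> (\<forall>t\<ge>0. bounded (v ` {0..t}))"

definition forced_solution ::
    "(real^'d::{finite,linorder} \<Rightarrow> real) \<Rightarrow> (real \<Rightarrow> real^'d::{finite,linorder}) \<Rightarrow>
     (real \<Rightarrow> real^'d::{finite,linorder}) \<Rightarrow> bool" where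
  "forced_solution \<phi> v w \<longleftrightarrow>
     (\<forall>t\<ge>0. ((\<lambda>\<tau>. drift \<phi> (w \<tau>) + v \<tau>) has_integral (w t - w 0)) {0..t})"

text \<open>The \<open>insert 0\<close> only matters at \<open>t = 0\<close>, where the supremum is over the empty set of
  nonnegative reals and has to be \<open>0\<close>; \<open>Sup {}\<close> is unspecified on the reals.\<close>

definition ISS_relative_to ::
    "(real^'d::{finite,linorder} \<Rightarrow> real) \<Rightarrow> (real^'d::{finite,linorder}) set \<Rightarrow> bool" where
  "ISS_relative_to \<phi> W \<longleftrightarrow>
     (\<exists>\<beta> \<gamma>. class_KL \<beta> \<and> class_K \<gamma> \<and>
        (\<forall>w0 v w. admissible_input v \<longrightarrow> forced_solution \<phi> v w \<longrightarrow> w 0 = w0 \<longrightarrow>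
           (\<forall>t\<ge>0. infdist (w t) W \<le>
              max (\<beta> (infdist w0 W) t)
                  (\<gamma> (Sup (insert 0 ((\<lambda>\<tau>. norm (v \<tau>)) ` {0..<t})))))))"

definition invariant_set ::
    "(real^'d::{finite,linorder} \<Rightarrow> real) \<Rightarrow> (real^'d::{finite,linorder}) set \<Rightarrow> bool" where
  "invariant_set \<phi> W \<longleftrightarrow>
     (\<forall>w. (\<forall>t\<ge>0. (w has_vector_derivative drift \<phi> (w t)) (at t within {0..})) \<longrightarrow>
        w 0 \<in> W \<longrightarrow> (\<forall>t\<ge>0. w t \<in> W))"

definition sym_pos_def :: "real^'d^'d \<Rightarrow> bool" where
  "sym_pos_def P \<longleftrightarrow> transpose P = P \<and> (\<forall>x. x \<noteq> 0 \<longrightarrow> x \<bullet> (P *v x) > 0)"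

definition riccati_solution ::
    "real \<Rightarrow> real \<Rightarrow> real^'d::{finite,linorder}^'d::{finite,linorder} \<Rightarrow> bool" where
  "riccati_solution \<mu> a P \<longleftrightarrow>
     prime_S ** P + P ** transpose prime_S
       - (2 * \<mu>) *\<^sub>R (P ** transpose prime_C ** prime_C ** P) + a *\<^sub>R mat 1 = 0"

definition network_solution ::
    "(real^'d::{finite,linorder} \<Rightarrow> real) \<Rightarrow> real^'n^'n \<Rightarrow> real^1^'d::{finite,linorder} \<Rightarrow> real \<Rightarrow>
     ('n::finite \<Rightarrow> real \<Rightarrow> real^'d::{finite,linorder}) \<Rightarrow> bool" where
  "network_solution \<phi> A K\<^sub>0 g w \<longleftrightarrow>
     (\<forall>k. \<forall>t\<ge>0.
        (w k has_vector_derivative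
           drift \<phi> (w k t)
             + (gain_D g ** K\<^sub>0) *v
                 (\<Sum>j\<in>UNIV. A $ k $ j *\<^sub>R (prime_C *v w j t - prime_C *v w k t)))
          (at t within {0..}))"

end

theory Submission
  imports Defs
begin

text \<open>Already the differences \<open>w\<^sub>k - w\<^sub>v\<close> to a root \<open>v\<close> of the graph decay exponentially, so \<open>w\<^sub>v\<close>
  itself serves as \<open>w\<^sup>*\<close>. With \<open>z\<^sub>k = D\<^sub>g\<^sup>-\<^sup>1 w\<^sub>k\<close> and a row vector \<open>\<rho>\<close> annihilating \<open>1\<close>, the combination
  \<open>y\<^sub>\<rho> = \<Sum>k. \<rho>\<^sub>k z\<^sub>k\<close> satisfies \<open>y\<^sub>\<rho>' = g (S y\<^sub>\<rho> - K\<^sub>0 C y\<^sub>\<rho>\<^sub>L)\<close> up to a term bounded, uniformly in \<open>g \<ge> 1\<close>,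
  by the differences of the \<open>z\<^sub>k\<close>. All eigenvalues of \<open>L\<^sup>T\<close> on the space of these \<open>\<rho>\<close> have real part at
  least \<open>\<mu>\<close>, so the space is spanned by the real and imaginary parts of an almost diagonalising
  basis. Summing \<open>y\<^sub>\<rho>\<^sup>T P\<^sup>-\<^sup>1 y\<^sub>\<rho>\<close> over this family gives a Lyapunov function: by the Riccati equation the
  linear part contributes at most \<open>- g a / 2 \<Sum> |P\<^sup>-\<^sup>1 y\<^sub>\<rho>|\<^sup>2\<close>, which absorbs the Lipschitz term once \<open>g\<close> is
  large.\<close>

no_notation fps_nth (infixl \<open>$\<close> 75)

section \<open>Left eigenvectors of the Laplacian\<close>

lemma laplacian_vec_nth:
  assumes "communication_graph E A"
  shows "(laplacian A *v x) $ k = (\<Sum>j\<in>UNIV. A $ k $ j * (x $ k - x $ j))"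
proof -
  have "A $ k $ k = 0"
    using assms unfolding communication_graph_def by blast
  have "(laplacian A *v x) $ k
      = (\<Sum>j\<in>UNIV. (if j = k then (\<Sum>i\<in>UNIV. A $ k $ i) * x $ k else 0) - A $ k $ j * x $ j)"
    unfolding laplacian_def matrix_vector_mult_def
    using \<open>A $ k $ k = 0\<close> by (auto intro!: sum.cong)
  then show ?thesis
    by (simp add: sum_subtractf sum_distrib_right right_diff_distrib)
qed

lemma laplacian_vec_const:
  assumes "communication_graph E A"
  shows "laplacian A *v vec c = 0"
  by (simp add: vec_eq_iff laplacian_vec_nth[OF assms])

text \<open>At a largest entry of \<open>x\<close> every summand of the corresponding row of L x is
  nonnegative, at a smallest entry nonpositive. Both rows equal \<open>c\<close>, which is squeezed
  to zero.\<close>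

lemma laplacian_image_const:
  fixes x :: "real^'n::finite"
  assumes graph: "communication_graph E A" and Lx: "laplacian A *v x = vec c"
  shows "c = 0"
proof -
  have c: "c = (\<Sum>j\<in>UNIV. A $ k $ j * (x $ k - x $ j))" for k
    using laplacian_vec_nth[OF graph, of x k] Lx by simp
  have nonneg: "A $ k $ j \<ge> 0" for k j
    using graph unfolding communication_graph_def by blast
  have fin: "finite (range (\<lambda>i. x $ i))" "range (\<lambda>i. x $ i) \<noteq> {}" by auto
  obtain k1 where k1: "x $ k1 = Max (range (\<lambda>i. x $ i))"
    using Max_in[OF fin] by (metis imageE)
  obtain k2 where k2: "x $ k2 = Min (range (\<lambda>i. x $ i))"
    using Min_in[OF fin] by (metis imageE)
  have "c \<ge> 0"
    unfolding c[of k1] using nonneg k1 fin by (intro sum_nonneg mult_nonneg_nonneg) auto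
  moreover have "c \<le> 0"
    unfolding c[of k2] using nonneg k2 fin by (intro sum_nonpos mult_nonneg_nonpos) auto
  ultimately show ?thesis by simp
qed

text \<open>A pair in \<open>E\<close> names the receiver first, so a path of information flow is a
  chain of pairs read backwards.\<close>

lemma graph_path_rtrancl:
  assumes "graph_path E v k p"
  shows "(k, v) \<in> E\<^sup>*"
proof -
  have "(p ! i, p ! 0) \<in> E\<^sup>*" if "i < length p" for i
    using that
  proof (induction i)
    case (Suc i)
    then show ?case
      using assms unfolding graph_path_def by (meson Suc_lessD converse_rtrancl_into_rtrancl)
  qed simp
  then show ?thesis
    using assms unfolding graph_path_def
    by (metis diff_less hd_conv_nth last_conv_nth length_greater_0_conv zero_less_one)
qed

text \<open>Discrete maximum principle: at a node where the maximum is attained, the summands of the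
  row of L x are nonnegative with sum zero, so every node sending to it attains the maximum too.
  Following the edges backwards ends at the root.\<close>

lemma laplacian_kernel_max_at_root:
  fixes x :: "real^'n::finite"
  assumes graph: "communication_graph E A" and root: "\<And>k. (k, v) \<in> E\<^sup>*"
    and Lx: "laplacian A *v x = 0"
  shows "x $ k \<le> x $ v"
proof -
  define m where "m = Max (range (\<lambda>i. x $ i))"
  have fin: "finite (range (\<lambda>i. x $ i))" "range (\<lambda>i. x $ i) \<noteq> {}" by auto
  have le: "x $ i \<le> m" for i
    unfolding m_def using fin by auto
  obtain k1 where k1: "x $ k1 = m"
    using Max_in[OF fin] unfolding m_def by (metis imageE)
  have step: "x $ j = m" if "(i, j) \<in> E" "x $ i = m" for i j
  proof -
    have "(\<Sum>j\<in>UNIV. A $ i $ j * (x $ i - x $ j)) = 0"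
      using laplacian_vec_nth[OF graph, of x i] Lx by simp
    moreover have "A $ i $ j * (x $ i - x $ j) \<ge> 0" for j
      using graph le that(2) unfolding communication_graph_def by simp
    ultimately have "A $ i $ j * (x $ i - x $ j) = 0"
      by (simp add: sum_nonneg_eq_0_iff)
    moreover have "A $ i $ j \<noteq> 0"
      using graph that(1) unfolding communication_graph_def by blast
    ultimately show ?thesis using that(2) by simp
  qed
  have "x $ v = m"
    using root[of k1] k1
  proof (induction rule: converse_rtrancl_induct)
    case (step y z)
    then show ?case using \<open>\<And>i j. (i, j) \<in> E \<Longrightarrow> x $ i = m \<Longrightarrow> x $ j = m\<close> by blast
  qed
  then show ?thesis using le by simp
qed

text \<open>Applied to \<open>- x\<close>, the maximum principle makes the root a minimum as
  well.\<close>

lemma laplacian_kernel_const: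
  fixes x :: "real^'n::finite"
  assumes "communication_graph E A" "\<And>k. (k, v) \<in> E\<^sup>*" "laplacian A *v x = 0"
  shows "x $ k = x $ v"
  using laplacian_kernel_max_at_root[OF assms(1,2), of x k]
    laplacian_kernel_max_at_root[OF assms(1,2), of "- x" k] assms(3)
  using matrix_vector_mult_diff_distrib[of "laplacian A" 0 x] by simp

text \<open>A left null vector \<open>q\<close> with \<open>\<Sum>q = 0\<close> is also one of the rank-one perturbation
  \<open>L + 1 e\<^sub>v\<^sup>T\<close>, and this matrix is nonsingular.\<close>

lemma laplacian_left_kernel:
  fixes q :: "real^'n::finite"
  assumes graph: "communication_graph E A" and root: "\<And>k. (k, v) \<in> E\<^sup>*"
    and qL: "q v* laplacian A = 0" and q1: "(\<Sum>k\<in>UNIV. q $ k) = 0"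
  shows "q = 0"
proof -
  define M :: "real^'n^'n" where "M = laplacian A + (\<chi> i j. if j = v then 1 else 0)"
  have rank1: "(\<chi> i j. if j = v then 1 else 0) *v x = vec (x $ v)" for x :: "real^'n"
    by (simp add: vec_eq_iff matrix_vector_mult_def if_distrib[of "\<lambda>z. z * _"] cong: if_cong)
  \<comment> \<open>Here L x is the constant vector with entries - x_v, so x_v = 0; then
    \<open>x\<close> lies in the kernel of L and is constant with value x_v.\<close>
  have "x = 0" if "M *v x = 0" for x
  proof -
    have *: "laplacian A *v x = vec (- (x $ v))"
      using that unfolding M_def matrix_vector_mult_add_rdistrib rank1
      by (simp add: vec_eq_iff eq_neg_iff_add_eq_0)
    have "x $ v = 0"
      using laplacian_image_const[OF graph *] by simp
    then have "x $ k = 0" for k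
      using laplacian_kernel_const[OF graph root, of x k] * by (simp add: vec_eq_iff)
    then show ?thesis by (simp add: vec_eq_iff)
  qed
  then obtain B where "M ** B = mat 1"
    using matrix_left_invertible_ker[of M] matrix_left_right_inverse by blast
  have "(q v* (\<chi> i j. if j = v then 1 else 0)) $ i = 0" for i
    using q1 by (cases "i = v") (simp_all add: vector_matrix_mult_def)
  then have "q v* (\<chi> i j. if j = v then 1 else 0) = 0"
    by (simp add: vec_eq_iff)
  then have "q v* M = 0"
    unfolding M_def using qL by (simp add: vector_matrix_mult_add_rdistrib)
  then have "q v* (M ** B) = 0"
    by (simp flip: vector_matrix_mul_assoc)
  then show ?thesis by (simp add: \<open>M ** B = mat 1\<close>)
qed

section \<open>Characteristic polynomials and left eigenvalues\<close>

lemma poly_det: "poly (det M) z = det (\<chi> i j. poly (M $ i $ j) z)"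
  for M :: "'a::comm_ring_1 poly^'n::finite^'n"
  by (simp add: det_def poly_sum poly_prod)

lemma poly_charpoly: "poly (charpoly M) z = det (mat z - M)"
  unfolding charpoly_def poly_det
  by (intro arg_cong[where f = det]) (simp add: vec_eq_iff mat_def)

lemma mat_vector_mul: "mat z *v x = z *s x" for z :: "'a::comm_semiring_1"
  by (simp add: vec_eq_iff matrix_vector_mult_def mat_def if_distrib[of "\<lambda>z. z * _"] cong: if_cong)

lemma det_zero_iff_eigenvector:
  fixes M :: "'a::field^'n::finite^'n"
  shows "det (mat z - M) = 0 \<longleftrightarrow> (\<exists>x. x \<noteq> 0 \<and> M *v x = z *s x)"
proof -
  have "det (mat z - M) \<noteq> 0 \<longleftrightarrow> (\<exists>B. B ** (mat z - M) = mat 1)"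
    by (metis invertible_def invertible_det_nz matrix_left_right_inverse)
  also have "\<dots> \<longleftrightarrow> (\<forall>x. (mat z - M) *v x = 0 \<longrightarrow> x = 0)"
    by (rule matrix_left_invertible_ker)
  finally show ?thesis
    by (auto simp: matrix_vector_mult_diff_rdistrib mat_vector_mul)
qed

text \<open>Compare moduli in a component where \<open>x\<close> is largest. This crude bound serves
  to find a number that is not an eigenvalue.\<close>

lemma eigenvalue_norm_le:
  fixes M :: "complex^'n::finite^'n"
  assumes "x \<noteq> 0" "M *v x = z *s x"
  shows "norm z \<le> (\<Sum>i\<in>UNIV. \<Sum>j\<in>UNIV. norm (M $ i $ j))"
proof -
  define m where "m = Max (range (\<lambda>i. norm (x $ i)))"
  have fin: "finite (range (\<lambda>i. norm (x $ i)))" "range (\<lambda>i. norm (x $ i)) \<noteq> {}" by auto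
  have le: "norm (x $ i) \<le> m" for i
    unfolding m_def using fin by auto
  obtain k where k: "norm (x $ k) = m"
    using Max_in[OF fin] unfolding m_def by (metis imageE)
  have "m > 0"
    using assms(1) le by (metis k norm_ge_zero norm_le_zero_iff order_le_less vec_eq_iff zero_index)
  have "norm z * m = norm ((M *v x) $ k)"
    using assms(2) k by (simp add: norm_mult)
  also have "\<dots> \<le> (\<Sum>j\<in>UNIV. norm (M $ k $ j * x $ j))"
    unfolding matrix_vector_mult_def by (simp add: norm_sum)
  also have "\<dots> \<le> (\<Sum>j\<in>UNIV. norm (M $ k $ j)) * m"
    unfolding sum_distrib_right by (intro sum_mono) (simp add: norm_mult le mult_left_mono)
  finally have "norm z \<le> (\<Sum>j\<in>UNIV. norm (M $ k $ j))"
    using \<open>m > 0\<close> by simp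
  also have "\<dots> \<le> (\<Sum>i\<in>UNIV. \<Sum>j\<in>UNIV. norm (M $ i $ j))"
    by (rule member_le_sum[where f = "\<lambda>i. \<Sum>j\<in>UNIV. norm (M $ i $ j)"]) (auto intro: sum_nonneg)
  finally show ?thesis .
qed

text \<open>A number beyond the eigenvalue bound is not a root. This matters because
  \<open>proots\<close> lists the roots of nonzero polynomials only.\<close>

lemma charpoly_nonzero: "charpoly M \<noteq> 0"
proof
  assume "charpoly M = 0"
  define z where "z = complex_of_real ((\<Sum>i\<in>UNIV. \<Sum>j\<in>UNIV. norm (M $ i $ j)) + 1)"
  have "det (mat z - M) = 0"
    using \<open>charpoly M = 0\<close> by (simp flip: poly_charpoly)
  then have "norm z \<le> (\<Sum>i\<in>UNIV. \<Sum>j\<in>UNIV. norm (M $ i $ j))"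
    unfolding det_zero_iff_eigenvector using eigenvalue_norm_le by blast
  then show False
    unfolding z_def norm_of_real by linarith
qed

abbreviation complex_matrix :: "real^'n^'m \<Rightarrow> complex^'n^'m" where
  "complex_matrix M \<equiv> (\<chi> i j. complex_of_real (M $ i $ j))"

text \<open>A left eigenvector is an eigenvector of the transpose, and transposition preserves the
  characteristic polynomial.\<close>

lemma left_eigenvalue_in_eigenvalues:
  fixes M :: "real^'n::finite^'n"
  assumes "q \<noteq> 0" "q v* complex_matrix M = z *s q"
  shows "z \<in># eigenvalues M"
proof -
  have "det (mat z - transpose (complex_matrix M)) = 0"
    using assms unfolding det_zero_iff_eigenvector transpose_matrix_vector by blast
  moreover have "mat z - transpose (complex_matrix M) = transpose (mat z - complex_matrix M)"
    by (auto simp: vec_eq_iff transpose_def mat_def)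
  ultimately have "poly (charpoly (complex_matrix M)) z = 0"
    unfolding poly_charpoly by (simp only: det_transpose)
  then show ?thesis
    unfolding eigenvalues_def by (simp add: charpoly_nonzero)
qed

text \<open>Only the value 0 could be lost in passing to \<open>other_eigenvalues\<close>, and
  \<open>laplacian_left_kernel\<close> excludes it for a zero-sum \<open>q\<close>.\<close>

lemma left_eigenvalue_laplacian_Re:
  fixes q :: "complex^'n::finite"
  assumes graph: "communication_graph E A" and root: "\<And>k. (k, v) \<in> E\<^sup>*"
    and mu: "\<forall>z \<in># other_eigenvalues (laplacian A). Re z \<ge> \<mu>"
    and q: "q \<noteq> 0" "(\<Sum>k\<in>UNIV. q $ k) = 0" "q v* complex_matrix (laplacian A) = z *s q"
  shows "Re z \<ge> \<mu>"
proof (cases "z = 0")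
  case True
  have *: "(\<Sum>i\<in>UNIV. complex_of_real (laplacian A $ i $ j) * q $ i) = 0" for j
    using q(3) unfolding True by (simp add: vec_eq_iff vector_matrix_mult_def mult.commute)
  \<comment> \<open>The Laplacian is real, so the real and imaginary parts of \<open>q\<close> are
    left null vectors separately.\<close>
  have "(\<chi> k. Re (q $ k)) v* laplacian A = 0" "(\<chi> k. Im (q $ k)) v* laplacian A = 0"
    using arg_cong[OF *, of Re] arg_cong[OF *, of Im] by (auto simp: vec_eq_iff vector_matrix_mult_def mult.commute)
  moreover have "(\<Sum>k\<in>UNIV. (\<chi> k. Re (q $ k)) $ k) = 0" "(\<Sum>k\<in>UNIV. (\<chi> k. Im (q $ k)) $ k) = 0"
    using arg_cong[OF q(2), of Re] arg_cong[OF q(2), of Im] by auto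
  ultimately have "(\<chi> k. Re (q $ k)) = 0" "(\<chi> k. Im (q $ k)) = 0"
    using laplacian_left_kernel[OF graph root] by blast+
  then have "q = 0" by (simp add: vec_eq_iff complex_eq_iff)
  then show ?thesis using q(1) by blast
next
  case False
  then have "z \<in># other_eigenvalues (laplacian A)"
    using left_eigenvalue_in_eigenvalues[OF q(1,3)]
    unfolding other_eigenvalues_def by (simp add: in_diff_count)
  then show ?thesis using mu by blast
qed

section \<open>Almost diagonal bases\<close>

text \<open>\<open>poly_apply T u p\<close> is \<open>p(T) u\<close>, evaluated by Horner's rule.\<close>

definition poly_apply ::
    "(complex^'n \<Rightarrow> complex^'n) \<Rightarrow> complex^'n \<Rightarrow> complex poly \<Rightarrow> complex^'n" where
  "poly_apply T u p = fold_coeffs (\<lambda>c x. c *s u + T x) p 0"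

context
  fixes T :: "complex^'n \<Rightarrow> complex^'n::finite"
  assumes T: "Vector_Spaces.linear (*s) (*s) T"
begin

lemma T_add: "T (x + y) = T x + T y"
  and T_scale: "T (c *s x) = c *s T x"
  and T_0: "T 0 = 0"
  and T_diff: "T (x - y) = T x - T y"
  using vec.linear_add[OF T] vec.linear_scale[OF T] vec.linear_0[OF T] vec.linear_diff[OF T] by auto

lemma poly_apply_0: "poly_apply T u 0 = 0"
  by (simp add: poly_apply_def)

lemma poly_apply_pCons: "poly_apply T u (pCons c p) = c *s u + T (poly_apply T u p)"
  by (cases "p = 0 \<and> c = 0") (auto simp: poly_apply_def T_0)

lemma poly_apply_add: "poly_apply T u (p + q) = poly_apply T u p + poly_apply T u q"
  by (induction p q rule: poly_induct2)
    (simp_all add: poly_apply_0 poly_apply_pCons T_add vector_sadd_rdistrib add_ac)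

lemma poly_apply_smult: "poly_apply T u (smult c p) = c *s poly_apply T u p"
  by (induction p)
    (simp_all add: poly_apply_0 poly_apply_pCons T_scale vector_add_ldistrib vector_smult_assoc)

lemma poly_apply_linear_factor:
  "poly_apply T u ([:- z, 1:] * p) = T (poly_apply T u p) - z *s poly_apply T u p"
proof -
  have "[:- z, 1:] * p = pCons 0 p + smult (- z) p"
    by simp
  then show ?thesis
    by (simp only: poly_apply_add poly_apply_smult poly_apply_pCons) simp
qed

lemma poly_apply_in_subspace:
  assumes "vec.subspace U" "T ` U \<subseteq> U" "u \<in> U"
  shows "poly_apply T u p \<in> U"
proof (induction p)
  case 0
  show ?case using assms(1) by (simp add: poly_apply_0 vec.subspace_0)
next
  case (pCons c p)
  then show ?case
    unfolding poly_apply_pCons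
    using assms by (intro vec.subspace_add vec.subspace_scale) auto
qed

text \<open>The iterates u, T u, T^2 u, ... lie in a finite-dimensional space and cannot all be
  independent; a dependency between them is such a polynomial.\<close>

lemma annihilating_poly: "\<exists>p. p \<noteq> 0 \<and> poly_apply T u p = 0"
proof (rule ccontr)
  assume "\<not> ?thesis"
  then have nz: "poly_apply T u p \<noteq> 0" if "p \<noteq> 0" for p
    using that by blast
  define f where "f n = poly_apply T u (monom 1 n)" for n
  have span: "vec.span (f ` {..<n}) \<subseteq> {poly_apply T u p | p. \<forall>i\<ge>n. coeff p i = 0}" (is "_ \<subseteq> ?S") for n
  proof (rule vec.span_minimal)
    have "f m = poly_apply T u (monom 1 m) \<and> (\<forall>i\<ge>n. coeff (monom (1::complex) m) i = 0)" if "m < n" for m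
      using that by (simp add: f_def)
    then show "f ` {..<n} \<subseteq> ?S" by blast
    show "vec.subspace ?S"
    proof (rule vec.subspaceI)
      have "0 = poly_apply T u 0 \<and> (\<forall>i\<ge>n. coeff (0 :: complex poly) i = 0)"
        by (simp add: poly_apply_0)
      then show "0 \<in> ?S" by blast
    next
      fix x y assume "x \<in> ?S" "y \<in> ?S"
      then obtain p q where "x = poly_apply T u p" "y = poly_apply T u q"
        "\<forall>i\<ge>n. coeff p i = 0" "\<forall>i\<ge>n. coeff q i = 0" by blast
      then have "x + y = poly_apply T u (p + q) \<and> (\<forall>i\<ge>n. coeff (p + q) i = 0)"
        by (simp add: poly_apply_add)
      then show "x + y \<in> ?S" by blast
    next
      fix c x assume "x \<in> ?S"
      then obtain p where "x = poly_apply T u p" "\<forall>i\<ge>n. coeff p i = 0" by blast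
      then have "c *s x = poly_apply T u (smult c p) \<and> (\<forall>i\<ge>n. coeff (smult c p) i = 0)"
        by (simp add: poly_apply_smult)
      then show "c *s x \<in> ?S" by blast
    qed
  qed
  \<comment> \<open>Otherwise X^n - p, with \<open>p\<close> free of powers from \<open>n\<close>
    on, would be a nonzero polynomial annihilating \<open>u\<close>.\<close>
  have notin: "f n \<notin> vec.span (f ` {..<n})" for n
  proof
    assume "f n \<in> vec.span (f ` {..<n})"
    then obtain p where p: "f n = poly_apply T u p" "\<forall>i\<ge>n. coeff p i = 0"
      using span by blast
    have "poly_apply T u (monom 1 n + smult (- 1) p) = 0"
      unfolding poly_apply_add poly_apply_smult using p(1) by (simp add: f_def)
    moreover have "coeff (monom 1 n + smult (- 1) p) n \<noteq> coeff 0 n"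
      using p(2) by simp
    then have "monom 1 n + smult (- 1) p \<noteq> 0"
      by metis
    ultimately show False using nz by blast
  qed
  have indep: "vec.independent (f ` {..<n}) \<and> card (f ` {..<n}) = n" for n
  proof (induction n)
    case 0
    show ?case by (simp add: vec.independent_empty)
  next
    case (Suc n)
    have "f n \<notin> f ` {..<n}"
      using notin[of n] vec.span_superset[of "f ` {..<n}"] by blast
    moreover have "f ` {..<Suc n} = insert (f n) (f ` {..<n})"
      by (simp add: lessThan_Suc)
    ultimately show ?case
      using Suc.IH vec.independent_insertI[OF notin[of n]] by simp
  qed
  have "card (f ` {..<Suc (CARD('n))}) \<le> vec.dim (UNIV :: (complex^'n) set)"
    using indep by (intro vec.independent_card_le_dim) auto
  then show False
    using indep[of "Suc (CARD('n))"] by (simp only: vec.dim_UNIV card_cart_basis)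
qed

text \<open>An eigenvector modulo \<open>V\<close>: among the nonzero polynomials with p(T) u in
  \<open>V\<close>, one of least degree is nonconstant and has a root \<open>z\<close>. Removing the
  factor X - z leaves a vector outside \<open>V\<close> by minimality, which T - z sends into
  \<open>V\<close>.\<close>

lemma quotient_eigenvector:
  assumes V: "vec.subspace V" "T ` V \<subseteq> V" and U: "vec.subspace U" "T ` U \<subseteq> U"
    and u: "u \<in> U" "u \<notin> V"
  obtains q z where "q \<in> U" "q \<notin> V" "T q - z *s q \<in> V"
proof -
  define good where "good p \<longleftrightarrow> p \<noteq> 0 \<and> poly_apply T u p \<in> V" for p
  obtain p0 where "good p0"
    unfolding good_def using annihilating_poly vec.subspace_0[OF V(1)] by metis
  then obtain p where p: "good p" and "\<And>p'. good p' \<Longrightarrow> degree p \<le> degree p'"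
    using ex_has_least_nat[of good p0 degree] by blast
  then have min: "\<not> good p'" if "degree p' < degree p" for p'
    using that leD by blast
  have "\<not> constant (poly p)"
  proof
    assume "constant (poly p)"
    then obtain c where "p = [:c:]"
      unfolding constant_degree by (rule degree_eq_zeroE)
    then have c: "p = [:c:]" "c \<noteq> 0"
      using p unfolding good_def by auto
    then have "c *s u \<in> V"
      using p unfolding good_def by (simp add: poly_apply_pCons poly_apply_0 T_0)
    then have "inverse c *s (c *s u) \<in> V"
      by (rule vec.subspace_scale[OF V(1)])
    then show False using c(2) u(2) by (simp add: vector_smult_assoc)
  qed
  then obtain z where "poly p z = 0"
    using fundamental_theorem_of_algebra by blast
  then obtain p' where p': "p = [:- z, 1:] * p'"
    by (metis poly_eq_0_iff_dvd dvd_def)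
  then have "p' \<noteq> 0" using p unfolding good_def by auto
  then have "degree p = Suc (degree p')"
    unfolding p' by (subst degree_mult_eq) auto
  then have "poly_apply T u p' \<notin> V"
    using min[of p'] \<open>p' \<noteq> 0\<close> unfolding good_def by simp
  then show thesis
    using that[of "poly_apply T u p'" z] poly_apply_in_subspace[OF U u(1)] p
    unfolding good_def p' poly_apply_linear_factor by blast
qed

text \<open>Otherwise T - z is injective on \<open>U\<close> and therefore maps \<open>V\<close>
  onto \<open>V\<close>. Then (T - z) q already has a preimage in \<open>V\<close>, and injectivity
  puts \<open>q\<close> itself into \<open>V\<close>.\<close>

lemma quotient_eigenvalue_is_eigenvalue:
  assumes V: "vec.subspace V" "T ` V \<subseteq> V" "V \<subseteq> U" and U: "vec.subspace U"
    and q: "q \<in> U" "q \<notin> V" "T q - z *s q \<in> V"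
  obtains x where "x \<in> U" "x \<noteq> 0" "T x = z *s x"
proof (rule ccontr)
  assume "\<not> thesis"
  then have inj: "x = 0" if "x \<in> U" "T x = z *s x" for x
    using \<open>\<not> thesis\<close> \<open>\<And>x. \<lbrakk>x \<in> U; x \<noteq> 0; T x = z *s x\<rbrakk> \<Longrightarrow> thesis\<close> that by blast
  define F where "F x = T x - z *s x" for x
  have lin: "Vector_Spaces.linear (*s) (*s) F"
    unfolding F_def using T by (intro vec.linear_compose_sub vec.linear_scale_self)
  have inj_on: "inj_on F U"
  proof (rule inj_onI)
    fix x y assume xy: "x \<in> U" "y \<in> U" "F x = F y"
    then have "T (x - y) = z *s (x - y)"
      unfolding F_def by (simp add: T_diff vector_ssub_ldistrib algebra_simps)
    then show "x = y" using inj[of "x - y"] vec.subspace_diff[OF U xy(1,2)] by simp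
  qed
  have "F ` V = V"
  proof (rule vec.subspace_dim_equal)
    show "vec.subspace (F ` V)" by (rule vec.linear_subspace_image[OF lin V(1)])
    show "F ` V \<subseteq> V"
      unfolding F_def using V by (auto intro!: vec.subspace_diff vec.subspace_scale)
    have "inj_on F (vec.span V)"
      using inj_on_subset[OF inj_on V(3)] by (simp add: vec.span_eq_iff[THEN iffD2, OF V(1)])
    then show "vec.dim V \<le> vec.dim (F ` V)"
      using vec.dim_image_eq[OF lin] by simp
  qed (rule V(1))
  moreover have "F q \<in> V" using q(3) by (simp add: F_def)
  ultimately obtain x where "x \<in> V" "F x = F q" by (metis imageE)
  then show False using inj_on q(1,2) V(3) by (metis inj_onD subsetD)
qed

text \<open>Scaling each new vector down keeps the off-diagonal coefficients of the triangular form
  below \<open>\<eta>\<close>.\<close>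

lemma almost_diagonal_basis:
  assumes U: "vec.subspace U" "T ` U \<subseteq> U" and "\<eta> > 0"
    and ev: "\<And>x z. x \<in> U \<Longrightarrow> x \<noteq> 0 \<Longrightarrow> T x = z *s x \<Longrightarrow> R z"
  obtains Q where "finite Q" "card Q \<le> CARD('n)" "Q \<subseteq> U" "U \<subseteq> vec.span Q"
    "\<And>q. q \<in> Q \<Longrightarrow> \<exists>z t. R z \<and> (\<forall>r\<in>Q. norm (t r) \<le> \<eta>) \<and> T q = z *s q + (\<Sum>r\<in>Q. t r *s r)"
proof -
  define form where "form Q q \<longleftrightarrow>
    (\<exists>z t. R z \<and> (\<forall>r\<in>Q. norm (t r) \<le> \<eta>) \<and> T q = z *s q + (\<Sum>r\<in>Q. t r *s r))" for Q q
  define good where "good Q \<longleftrightarrow> finite Q \<and> vec.independent Q \<and> Q \<subseteq> U \<and> (\<forall>q\<in>Q. form Q q)" for Q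
  have bound: "card Q \<le> CARD('n)" if "good Q" for Q
    using that vec.independent_card_le_dim[of Q UNIV] unfolding good_def
    by (simp add: vec.dim_UNIV card_cart_basis)
  have "good {}"
    unfolding good_def by (simp add: vec.independent_empty)
  \<comment> \<open>Good sets are independent, so their sizes are bounded and a largest one exists.
    If it did not span \<open>U\<close>, it could be enlarged.\<close>
  then obtain Q where Q: "good Q" and max: "\<And>Q'. good Q' \<Longrightarrow> card Q' \<le> card Q"
    using ex_has_greatest_nat[of good "{}" card "Suc (CARD('n))"] bound by (metis le_imp_less_Suc)
  have fin: "finite Q" and indep: "vec.independent Q" and QU: "Q \<subseteq> U"
    using Q unfolding good_def by auto
  have "U \<subseteq> vec.span Q"
  proof (rule ccontr)
    assume "\<not> ?thesis"
    then obtain u where u: "u \<in> U" "u \<notin> vec.span Q" by blast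
    have TV: "T ` vec.span Q \<subseteq> vec.span Q"
    proof -
      have "T ` Q \<subseteq> vec.span Q"
      proof
        fix y assume "y \<in> T ` Q"
        then obtain q where "q \<in> Q" "y = T q" by blast
        then obtain z t where "y = z *s q + (\<Sum>r\<in>Q. t r *s r)"
          using Q unfolding good_def form_def by meson
        then show "y \<in> vec.span Q"
          using \<open>q \<in> Q\<close> by (simp add: vec.span_add vec.span_scale vec.span_sum vec.span_base)
      qed
      then show ?thesis
        unfolding vec.linear_span_image[OF T, symmetric] by (simp add: vec.span_minimal)
    qed
    have VU: "vec.span Q \<subseteq> U" by (rule vec.span_minimal[OF QU U(1)])
    obtain q z where q: "q \<in> U" "q \<notin> vec.span Q" "T q - z *s q \<in> vec.span Q"
      using quotient_eigenvector[OF vec.subspace_span TV U u] by blast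
    \<comment> \<open>So far \<open>z\<close> is an eigenvalue only modulo the span of
      \<open>Q\<close>, whereas \<open>ev\<close> speaks of genuine eigenvalues on
      \<open>U\<close>.\<close>
    have "R z"
      using quotient_eigenvalue_is_eigenvalue[OF vec.subspace_span TV VU U(1) q] ev by blast
    obtain t where t: "T q - z *s q = (\<Sum>r\<in>Q. t r *s r)"
      using q(3) unfolding vec.span_finite[OF fin] by auto
    \<comment> \<open>The denominator dominates every norm of a coefficient \<open>t r\<close>; the
      1 keeps it positive even when all of them vanish.\<close>
    define s where "s = \<eta> / (1 + (\<Sum>r\<in>Q. norm (t r)))"
    have pos: "1 + (\<Sum>r\<in>Q. norm (t r)) > 0"
      by (intro add_pos_nonneg sum_nonneg) simp_all
    have "s > 0" unfolding s_def using \<open>\<eta> > 0\<close> pos by simp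
    have small: "norm (of_real s * t r) \<le> \<eta>" if "r \<in> Q" for r
    proof -
      have "norm (t r) \<le> 1 + (\<Sum>r\<in>Q. norm (t r))"
        using member_le_sum[OF that, of "\<lambda>r. norm (t r)"] fin by simp
      then have "\<eta> * norm (t r) \<le> \<eta> * (1 + (\<Sum>r\<in>Q. norm (t r)))"
        using \<open>\<eta> > 0\<close> by (intro mult_left_mono) auto
      moreover have "norm (of_real s * t r) = s * norm (t r)"
        using \<open>s > 0\<close> by (simp add: norm_mult)
      ultimately show ?thesis
        using pos by (simp add: s_def divide_le_eq)
    qed
    define p where "p = of_real s *s q"
    have pV: "p \<notin> vec.span Q"
    proof
      assume "p \<in> vec.span Q"
      then have "inverse (of_real s) *s p \<in> vec.span Q" by (rule vec.span_scale)
      then show False using q(2) \<open>s > 0\<close> by (simp add: p_def vector_smult_assoc)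
    qed
    then have pQ: "p \<notin> Q" using vec.span_superset[of Q] by blast
    have "T p = of_real s *s (z *s q + (\<Sum>r\<in>Q. t r *s r))"
      unfolding p_def T_scale using t by (simp add: algebra_simps)
    also have "\<dots> = z *s p + (\<Sum>r\<in>Q. (of_real s * t r) *s r)"
      by (simp add: p_def vector_add_ldistrib vec.scale_sum_right vector_smult_assoc mult.commute)
    finally have Tp: "T p = z *s p + (\<Sum>r\<in>Q. (of_real s * t r) *s r)" .
    \<comment> \<open>A representation over \<open>Q\<close> extends by the coefficient 0 at
      \<open>p\<close>, so the old vectors keep their form and the new one has only old vectors in
      its remainder.\<close>
    have ext: "form (insert p Q) x" if "R z" "\<forall>r\<in>Q. norm (t r) \<le> \<eta>"
      "T x = z *s x + (\<Sum>r\<in>Q. t r *s r)" for x z t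
    proof -
      have "(\<Sum>r\<in>insert p Q. (if r = p then 0 else t r) *s r) = (\<Sum>r\<in>Q. t r *s r)"
        using fin pQ by (auto intro!: sum.cong)
      then show ?thesis
        unfolding form_def using that \<open>\<eta> > 0\<close>
        by (intro exI[of _ z] exI[of _ "\<lambda>r. if r = p then 0 else t r"] conjI ballI) (auto simp del: sum.insert)
    qed
    have "form (insert p Q) p"
      by (rule ext[OF \<open>R z\<close> _ Tp]) (use small in blast)
    moreover have "form (insert p Q) x" if xQ: "x \<in> Q" for x
      proof -
      obtain z t where "R z" "\<forall>r\<in>Q. norm (t r) \<le> \<eta>" "T x = z *s x + (\<Sum>r\<in>Q. t r *s r)"
        using Q xQ unfolding good_def form_def by meson
      then show ?thesis by (rule ext)
    qed
    moreover have "p \<in> U" unfolding p_def using q(1) U(1) by (rule vec.subspace_scale[rotated])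
    ultimately have "good (insert p Q)"
      unfolding good_def using fin QU vec.independent_insertI[OF pV indep] by simp
    then show False using max[of "insert p Q"] fin pQ by simp
  qed
  then show thesis
    using Q by (intro that[OF fin bound[OF Q] QU]) (auto simp: good_def form_def)
qed

end

section \<open>Passing from complex row vectors to real ones\<close>

definition Re_vec :: "complex^'n \<Rightarrow> real^'n" where
  "Re_vec q = (\<chi> k. Re (q $ k))"

definition Im_vec :: "complex^'n \<Rightarrow> real^'n" where
  "Im_vec q = (\<chi> k. Im (q $ k))"

lemma Re_vec_add: "Re_vec (p + q) = Re_vec p + Re_vec q"
  and Im_vec_add: "Im_vec (p + q) = Im_vec p + Im_vec q"
  and Re_vec_scale: "Re_vec (z *s q) = Re z *\<^sub>R Re_vec q - Im z *\<^sub>R Im_vec q"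
  and Im_vec_scale: "Im_vec (z *s q) = Re z *\<^sub>R Im_vec q + Im z *\<^sub>R Re_vec q"
  and Re_vec_0: "Re_vec 0 = 0"
  and Im_vec_0: "Im_vec 0 = 0"
  by (simp_all add: Re_vec_def Im_vec_def vec_eq_iff)

lemma Re_vec_sum: "Re_vec (\<Sum>i\<in>I. f i) = (\<Sum>i\<in>I. Re_vec (f i))"
  by (simp add: Re_vec_def vec_eq_iff)

lemma Re_vec_mult_complex_matrix: "Re_vec (q v* complex_matrix M) = Re_vec q v* M"
  and Im_vec_mult_complex_matrix: "Im_vec (q v* complex_matrix M) = Im_vec q v* M"
  by (simp_all add: Re_vec_def Im_vec_def vec_eq_iff vector_matrix_mult_def)

text \<open>The complex-linear extension of a real functional, by which relations with complex
  coefficients are evaluated along \<open>c\<close>.\<close>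

definition complexify :: "(real^'n \<Rightarrow> real) \<Rightarrow> complex^'n \<Rightarrow> complex" where
  "complexify c q = Complex (c (Re_vec q)) (c (Im_vec q))"

lemma complexify_add: "linear c \<Longrightarrow> complexify c (p + q) = complexify c p + complexify c q"
  by (simp add: complexify_def Re_vec_add Im_vec_add linear_add complex_eq_iff)

lemma complexify_scale: "linear c \<Longrightarrow> complexify c (z *s q) = z * complexify c q"
  by (simp add: complexify_def Re_vec_scale Im_vec_scale linear_add linear_diff linear_scale complex_eq_iff)

lemma complexify_sum: "linear c \<Longrightarrow> complexify c (\<Sum>i\<in>I. f i) = (\<Sum>i\<in>I. complexify c (f i))"
  by (induction I rule: infinite_finite_induct)
    (simp_all add: complexify_add, simp_all add: complexify_def Re_vec_0 Im_vec_0 linear_0 complex_eq_iff)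

text \<open>Equivalently, \<open>X = \<Sum>i\<in>I. \<rho>\<^sub>i \<rho>\<^sub>i\<^sup>T\<close> satisfies \<open>L\<^sup>T X + X L \<ge> 2 (\<mu> - \<epsilon>) X\<close>. The family
  consists of the real and imaginary parts of an almost diagonalising basis.\<close>

lemma laplacian_lyapunov_family:
  fixes A :: "real^'n::finite^'n"
  assumes graph: "communication_graph E A" and root: "\<And>k. (k, v) \<in> E\<^sup>*"
    and mu: "\<forall>z \<in># other_eigenvalues (laplacian A). Re z \<ge> \<mu>" and "\<epsilon> > 0"
  obtains I :: "((complex^'n) \<times> bool) set" and \<rho> :: "(complex^'n) \<times> bool \<Rightarrow> real^'n" and s
  where "finite I" "\<And>i. i \<in> I \<Longrightarrow> (\<Sum>k\<in>UNIV. \<rho> i $ k) = 0"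
    "\<And>k. axis k 1 - axis v 1 = (\<Sum>i\<in>I. s k i *\<^sub>R \<rho> i)"
    "\<And>c. linear c \<Longrightarrow>
      (\<mu> - \<epsilon>) * (\<Sum>i\<in>I. (c (\<rho> i))\<^sup>2) \<le> (\<Sum>i\<in>I. c (\<rho> i) * c (\<rho> i v* laplacian A))"
proof -
  define T where "T q = q v* complex_matrix (laplacian A)" for q
  have "T = (*v) (transpose (complex_matrix (laplacian A)))"
    by (simp add: fun_eq_iff T_def)
  then have T: "Vector_Spaces.linear (*s) (*s) T"
    by (simp only: matrix_vector_mul_linear_gen)
  \<comment> \<open>These are the row vectors annihilating the all-ones vector; \<open>T\<close>
    preserves them because each row of the Laplacian sums to zero.\<close>
  define U where "U = {q :: complex^'n. (\<Sum>k\<in>UNIV. q $ k) = 0}"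
  have U: "vec.subspace U"
    unfolding U_def by (auto simp: vec.subspace_def sum.distrib simp flip: sum_distrib_left)
  have row: "(\<Sum>j\<in>UNIV. laplacian A $ k $ j) = 0" for k
    using laplacian_vec_const[OF graph, of 1] by (simp add: vec_eq_iff matrix_vector_mult_def)
  have TU: "T ` U \<subseteq> U"
  proof
    fix y assume "y \<in> T ` U"
    then obtain q where y: "y = T q" by blast
    have "(\<Sum>j\<in>UNIV. T q $ j) = (\<Sum>k\<in>UNIV. of_real (\<Sum>j\<in>UNIV. laplacian A $ k $ j) * q $ k)"
      unfolding T_def vector_matrix_mult_def of_real_sum sum_distrib_right vec_lambda_beta
      by (rule sum.swap[THEN trans]) (simp add: mult.commute)
    then show "y \<in> U" by (simp add: row U_def y)
  qed
  \<comment> \<open>The cross terms sum to at most \<eta> G^2, and bounding G^2 by a sum of squares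
    costs a factor of at most \<open>CARD('n)\<close>.\<close>
  define \<eta> where "\<eta> = \<epsilon> / CARD('n)"
  have "\<eta> > 0" unfolding \<eta>_def using \<open>\<epsilon> > 0\<close> by simp
  have ev: "Re z \<ge> \<mu>" if "x \<in> U" "x \<noteq> 0" "T x = z *s x" for x z
    using that unfolding U_def T_def
    by (intro left_eigenvalue_laplacian_Re[OF graph root mu, of x]) simp_all
  obtain Q where Q: "finite Q" "card Q \<le> CARD('n)" "Q \<subseteq> U" "U \<subseteq> vec.span Q"
    and form: "\<And>q. q \<in> Q \<Longrightarrow>
      \<exists>z t. Re z \<ge> \<mu> \<and> (\<forall>r\<in>Q. norm (t r) \<le> \<eta>) \<and> T q = z *s q + (\<Sum>r\<in>Q. t r *s r)"
  proof (rule almost_diagonal_basis[OF T U TU \<open>\<eta> > 0\<close>, of "\<lambda>z. Re z \<ge> \<mu>"])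
    show "Re z \<ge> \<mu>" if "x \<in> U" "x \<noteq> 0" "T x = z *s x" for x z
      by (rule ev[OF that])
  qed (rule that)
  define \<rho> where "\<rho> i = (if snd i then Re_vec (fst i) else Im_vec (fst i))" for i :: "(complex^'n) \<times> bool"
  have sum_I: "(\<Sum>i\<in>Q \<times> UNIV. f i) = (\<Sum>q\<in>Q. f (q, True) + f (q, False))"
    for f :: "(complex^'n) \<times> bool \<Rightarrow> 'b::comm_monoid_add"
    by (simp add: sum.cartesian_product' UNIV_bool add.commute)
  have "\<exists>s. axis k 1 - axis v 1 = (\<Sum>i\<in>Q \<times> UNIV. s i *\<^sub>R \<rho> i)" for k
  proof -
    have "axis k 1 - axis v 1 \<in> U"
      unfolding U_def by (simp add: sum_subtractf axis_def)
    then obtain u where u: "axis k 1 - axis v 1 = (\<Sum>r\<in>Q. u r *s r)"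
      using Q(4) unfolding vec.span_finite[OF Q(1)] by blast
    have "(axis k 1 - axis v 1 :: real^'n) = Re_vec (axis k 1 - axis v 1)"
      by (simp add: Re_vec_def vec_eq_iff axis_def)
    also have "\<dots> = (\<Sum>r\<in>Q. Re (u r) *\<^sub>R Re_vec r - Im (u r) *\<^sub>R Im_vec r)"
      unfolding u Re_vec_sum Re_vec_scale ..
    also have "\<dots> = (\<Sum>i\<in>Q \<times> UNIV. (if snd i then Re (u (fst i)) else - Im (u (fst i))) *\<^sub>R \<rho> i)"
      unfolding sum_I by (simp add: \<rho>_def)
    finally show ?thesis
      by (rule exI[of _ "\<lambda>i. if snd i then Re (u (fst i)) else - Im (u (fst i))"])
  qed
  then obtain s where s: "\<And>k. axis k 1 - axis v 1 = (\<Sum>i\<in>Q \<times> UNIV. s k i *\<^sub>R \<rho> i)"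
    by metis
  have zero_sum: "(\<Sum>k\<in>UNIV. \<rho> i $ k) = 0" if "i \<in> Q \<times> UNIV" for i
  proof -
    have "(\<Sum>k\<in>UNIV. fst i $ k) = 0"
      using that Q(3) unfolding U_def by auto
    from arg_cong[OF this, of Re] arg_cong[OF this, of Im] show ?thesis
      by (simp add: \<rho>_def Re_vec_def Im_vec_def)
  qed
  have lyap: "(\<mu> - \<epsilon>) * (\<Sum>i\<in>Q \<times> UNIV. (c (\<rho> i))\<^sup>2)
      \<le> (\<Sum>i\<in>Q \<times> UNIV. c (\<rho> i) * c (\<rho> i v* laplacian A))" if c: "linear c" for c
  proof -
    \<comment> \<open>The real and imaginary parts of \<open>q\<close> together contribute |\<gamma>
      q|^2 to the sum of squares, and the real part of cnj (\<gamma> q) \<gamma>(T q) to the sum of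
      products.\<close>
    define \<gamma> where "\<gamma> = complexify c"
    define G where "G = (\<Sum>r\<in>Q. norm (\<gamma> r))"
    \<comment> \<open>The diagonal part of T q gives Re z |\<gamma> q|^2 with Re z at least \<mu>;
      the remainder has coefficients of modulus at most \<eta>.\<close>
    have each: "\<mu> * (norm (\<gamma> q))\<^sup>2 - \<eta> * norm (\<gamma> q) * G \<le> Re (cnj (\<gamma> q) * \<gamma> (T q))" if q: "q \<in> Q" for q
    proof -
      obtain z t where zt: "Re z \<ge> \<mu>" "\<forall>r\<in>Q. norm (t r) \<le> \<eta>" "T q = z *s q + (\<Sum>r\<in>Q. t r *s r)"
        using form[OF q] by blast
      have "cnj (\<gamma> q) * \<gamma> (T q) = z * of_real ((norm (\<gamma> q))\<^sup>2) + cnj (\<gamma> q) * (\<Sum>r\<in>Q. t r * \<gamma> r)"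
        unfolding zt(3) \<gamma>_def complexify_add[OF c] complexify_scale[OF c] complexify_sum[OF c]
        by (simp only: complex_norm_square) (simp add: algebra_simps)
      then have "Re (cnj (\<gamma> q) * \<gamma> (T q))
          = Re z * (norm (\<gamma> q))\<^sup>2 + Re (cnj (\<gamma> q) * (\<Sum>r\<in>Q. t r * \<gamma> r))"
        by simp
      moreover have "\<mu> * (norm (\<gamma> q))\<^sup>2 \<le> Re z * (norm (\<gamma> q))\<^sup>2"
        using zt(1) by (intro mult_right_mono) auto
      moreover have "norm (\<Sum>r\<in>Q. t r * \<gamma> r) \<le> \<eta> * G"
        unfolding G_def sum_distrib_left
        using zt(2) by (intro sum_norm_le) (simp add: norm_mult mult_right_mono)
      then have "norm (cnj (\<gamma> q) * (\<Sum>r\<in>Q. t r * \<gamma> r)) \<le> norm (\<gamma> q) * (\<eta> * G)"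
        by (simp add: norm_mult mult_left_mono)
      then have "- (\<eta> * norm (\<gamma> q) * G) \<le> Re (cnj (\<gamma> q) * (\<Sum>r\<in>Q. t r * \<gamma> r))"
        using abs_Re_le_cmod[of "cnj (\<gamma> q) * (\<Sum>r\<in>Q. t r * \<gamma> r)"] by (simp only: mult_ac)
      ultimately show ?thesis by linarith
    qed
    have sq: "(\<Sum>i\<in>Q \<times> UNIV. (c (\<rho> i))\<^sup>2) = (\<Sum>q\<in>Q. (norm (\<gamma> q))\<^sup>2)"
      unfolding sum_I by (simp add: \<rho>_def \<gamma>_def complexify_def cmod_power2)
    have prod: "(\<Sum>i\<in>Q \<times> UNIV. c (\<rho> i) * c (\<rho> i v* laplacian A)) = (\<Sum>q\<in>Q. Re (cnj (\<gamma> q) * \<gamma> (T q)))"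
      unfolding sum_I by (simp add: \<rho>_def \<gamma>_def complexify_def T_def
          Re_vec_mult_complex_matrix Im_vec_mult_complex_matrix)
    have "G\<^sup>2 \<le> (\<Sum>q\<in>Q. (norm (\<gamma> q))\<^sup>2) * card Q"
      unfolding G_def by (rule sum_squared_le_sum_of_squares)
    also have "\<dots> \<le> (\<Sum>q\<in>Q. (norm (\<gamma> q))\<^sup>2) * CARD('n)"
      using Q(2) by (intro mult_left_mono sum_nonneg) auto
    finally have "\<eta> * G\<^sup>2 \<le> \<eta> * ((\<Sum>q\<in>Q. (norm (\<gamma> q))\<^sup>2) * CARD('n))"
      using \<open>\<eta> > 0\<close> by (intro mult_left_mono) auto
    then have "\<eta> * G\<^sup>2 \<le> \<epsilon> * (\<Sum>q\<in>Q. (norm (\<gamma> q))\<^sup>2)"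
      by (simp add: \<eta>_def)
    moreover have "\<mu> * (\<Sum>q\<in>Q. (norm (\<gamma> q))\<^sup>2) - \<eta> * G\<^sup>2
        = (\<Sum>q\<in>Q. \<mu> * (norm (\<gamma> q))\<^sup>2 - \<eta> * norm (\<gamma> q) * G)"
      by (simp only: sum_subtractf sum_distrib_left[symmetric] sum_distrib_right[symmetric]
          G_def[symmetric] power2_eq_square mult.assoc)
    moreover have "\<dots> \<le> (\<Sum>q\<in>Q. Re (cnj (\<gamma> q) * \<gamma> (T q)))"
      by (rule sum_mono) (rule each)
    ultimately show ?thesis
      unfolding sq prod left_diff_distrib by linarith
  qed
  show thesis
    by (rule that[OF _ zero_sum s lyap]) (simp_all add: Q(1))
qed

section \<open>Prime form and Riccati equation\<close>

lemma idx_le_card: "idx (i :: 'd::{finite,linorder}) \<le> CARD('d)"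
  unfolding idx_def by (rule card_mono) auto

lemma gain_D_vec_nth: "(gain_D g *v x) $ i = g ^ idx i * x $ i"
  by (simp add: gain_D_def matrix_vector_mult_def if_distrib[of "\<lambda>z. z * _"] cong: if_cong)

lemma gain_D_inverse: "g \<noteq> 0 \<Longrightarrow> gain_D g *v (gain_D (inverse g) *v x) = x"
  by (simp add: vec_eq_iff gain_D_vec_nth power_inverse)

text \<open>\<open>prime_S\<close> moves each coordinate to the preceding index, and neighbouring
  diagonal entries of \<open>gain_D\<close> differ by one factor \<open>g\<close>.\<close>

lemma gain_D_prime_S:
  fixes x :: "real^'d::{finite,linorder}"
  assumes "g \<noteq> 0"
  shows "gain_D (inverse g) *v (prime_S *v x) = g *\<^sub>R (prime_S *v (gain_D (inverse g) *v x))"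
proof -
  have "inverse g ^ idx i * (prime_S $ i $ j * x $ j)
      = g * (prime_S $ i $ j * (gain_D (inverse g) *v x) $ j)" for i j :: 'd
    using assms by (simp add: prime_S_def gain_D_vec_nth)
  then have "inverse g ^ idx i * (prime_S *v x) $ i
      = g * (prime_S *v (gain_D (inverse g) *v x)) $ i" for i
    by (simp only: matrix_vector_mult_def[of prime_S] vec_lambda_beta sum_distrib_left)
  then show ?thesis
    by (simp add: vec_eq_iff gain_D_vec_nth)
qed

lemma gain_D_prime_B:
  fixes s :: "real^1"
  shows "gain_D h *v ((prime_B :: real^1^'d::{finite,linorder}) *v s) = h ^ CARD('d) *\<^sub>R (prime_B *v s)"
  by (simp add: vec_eq_iff gain_D_vec_nth) (simp add: matrix_vector_mult_def prime_B_def)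

lemma prime_C_gain_D:
  assumes "g \<noteq> 0"
  shows "prime_C *v x = g *\<^sub>R (prime_C *v (gain_D (inverse g) *v x))"
proof -
  have "prime_C $ i $ j * x $ j = g * (prime_C $ i $ j * (gain_D (inverse g) *v x) $ j)" for i j
    using assms by (simp add: prime_C_def gain_D_vec_nth)
  then have "(prime_C *v x) $ i = g * (prime_C *v (gain_D (inverse g) *v x)) $ i" for i
    by (simp only: matrix_vector_mult_def[of prime_C] vec_lambda_beta sum_distrib_left)
  then show ?thesis
    by (simp add: vec_eq_iff)
qed

lemma norm_gain_D_le:
  fixes x :: "real^'d::{finite,linorder}"
  assumes "g \<ge> 1"
  shows "norm (gain_D g *v x) \<le> g ^ CARD('d) * norm x"
proof -
  have "norm ((gain_D g *v x) $ i) \<le> norm ((g ^ CARD('d) *\<^sub>R x) $ i)" for i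
    using assms idx_le_card[of i]
    by (simp add: gain_D_vec_nth abs_mult mult_right_mono power_increasing)
  then have "norm (gain_D g *v x) \<le> norm (g ^ CARD('d) *\<^sub>R x)"
    by (rule norm_le_componentwise_cart)
  then show ?thesis using assms by simp
qed

section \<open>Positive definite quadratic forms and decay of Lyapunov functions\<close>

lemma inner_transpose: "x \<bullet> (transpose M *v y) = (M *v x) \<bullet> y" for M :: "real^'n^'m"
  using dot_lmul_matrix[of y M x] by (simp add: inner_commute)

lemma sym_pos_def_inner_commute:
  assumes "sym_pos_def P"
  shows "x \<bullet> (P *v y) = (P *v x) \<bullet> y"
  using assms inner_transpose[of x P y] by (simp add: sym_pos_def_def del: transpose_matrix_vector)

text \<open>\<open>R\<close> is the inverse of \<open>P\<close>, later the weight of the Lyapunov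
  function; it inherits the symmetry of \<open>P\<close>.\<close>

lemma sym_pos_def_inverse:
  assumes "sym_pos_def P"
  obtains R where "\<And>x. P *v (R *v x) = x" "\<And>x y. (R *v x) \<bullet> y = x \<bullet> (R *v y)"
proof -
  have "x = 0" if "P *v x = 0" for x
    using assms that by (fastforce simp: sym_pos_def_def)
  then obtain R where "P ** R = mat 1"
    using matrix_left_invertible_ker[of P] matrix_left_right_inverse by blast
  then have PR: "P *v (R *v x) = x" for x
    by (simp add: matrix_vector_mul_assoc)
  moreover have "(R *v x) \<bullet> y = x \<bullet> (R *v y)" for x y
    using sym_pos_def_inner_commute[OF assms, of "R *v x" "R *v y"] by (simp add: PR)
  ultimately show thesis using that by blast
qed

text \<open>By homogeneity the minimum of the form on the compact unit sphere serves as
  \<delta>.\<close>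

lemma sym_pos_def_coercive:
  fixes P :: "real^'d::finite^'d"
  assumes "sym_pos_def P"
  obtains \<delta> where "\<delta> > 0" "\<And>x. \<delta> * (x \<bullet> x) \<le> x \<bullet> (P *v x)"
proof -
  have "continuous_on (sphere 0 1) (\<lambda>x. x \<bullet> (P *v x))"
    by (intro continuous_intros linear_continuous_on matrix_vector_mul_bounded_linear)
  moreover have "sphere (0 :: real^'d) 1 \<noteq> {}"
    by simp
  ultimately obtain e where e: "e \<in> sphere 0 1" "\<And>x. x \<in> sphere 0 1 \<Longrightarrow> e \<bullet> (P *v e) \<le> x \<bullet> (P *v x)"
    using continuous_attains_inf[OF compact_sphere] by blast
  have "e \<noteq> 0" using e(1) by auto
  then have pos: "e \<bullet> (P *v e) > 0"
    using assms unfolding sym_pos_def_def by blast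
  have "(e \<bullet> (P *v e)) * (x \<bullet> x) \<le> x \<bullet> (P *v x)" for x
  proof (cases "x = 0")
    case False
    define u where "u = x /\<^sub>R norm x"
    have "e \<bullet> (P *v e) \<le> u \<bullet> (P *v u)"
      using False by (intro e(2)) (simp add: u_def)
    then have "(norm x)\<^sup>2 * (e \<bullet> (P *v e)) \<le> (norm x)\<^sup>2 * (u \<bullet> (P *v u))"
      by (rule mult_left_mono) simp
    also have "\<dots> = (norm x *\<^sub>R u) \<bullet> (P *v (norm x *\<^sub>R u))"
      by (simp add: power2_eq_square matrix_vector_mult_scaleR)
    also have "norm x *\<^sub>R u = x"
      using False by (simp add: u_def)
    finally show ?thesis by (simp add: power2_norm_eq_inner mult.commute)
  qed simp
  then show thesis using pos that by blast
qed

text \<open>Pair the Riccati equation with \<open>x\<close> on both sides; symmetry of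
  \<open>P\<close> makes the two terms in \<open>prime_S\<close> equal. It is applied with x = R y,
  where P x = y turns the left side into the drift part of the Lyapunov derivative.\<close>

lemma riccati_quadratic_form:
  assumes "sym_pos_def P" "riccati_solution \<mu> a P"
  shows "2 * (x \<bullet> (prime_S *v (P *v x))) = 2 * \<mu> * ((prime_C *v (P *v x)) $ 1)\<^sup>2 - a * (x \<bullet> x)"
proof -
  note adj = sym_pos_def_inner_commute[OF assms(1)]
  have "x \<bullet> ((prime_S ** P + P ** transpose prime_S
       - (2 * \<mu>) *\<^sub>R (P ** transpose prime_C ** prime_C ** P) + a *\<^sub>R mat 1) *v x) = 0"
    using assms(2) unfolding riccati_solution_def by simp
  then have "x \<bullet> (prime_S *v (P *v x)) + x \<bullet> (P *v (transpose prime_S *v x))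
       - 2 * \<mu> * (x \<bullet> (P *v (transpose prime_C *v (prime_C *v (P *v x))))) + a * (x \<bullet> x) = 0"
    by (simp only: matrix_vector_mult_add_rdistrib matrix_vector_mult_diff_rdistrib
        scaleR_matrix_vector_assoc[symmetric] matrix_vector_mul_assoc[symmetric]
        inner_add_right inner_diff_right inner_scaleR_right matrix_vector_mul_lid)
  moreover have "x \<bullet> (P *v (transpose prime_S *v x)) = x \<bullet> (prime_S *v (P *v x))"
    by (simp only: adj[of x] inner_transpose) (simp only: inner_commute)
  moreover have "x \<bullet> (P *v (transpose prime_C *v (prime_C *v (P *v x))))
      = ((prime_C *v (P *v x)) $ 1)\<^sup>2"
    by (simp only: adj[of x] inner_transpose) (simp add: inner_vec_def power2_eq_square)
  ultimately show ?thesis by simp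
qed

text \<open>Gronwall argument: exp(c t) V(t) is nonincreasing, so V decays at least like exp(- c
  t).\<close>

lemma exponential_decay_tendsto_zero:
  fixes V V' :: "real \<Rightarrow> real"
  assumes deriv: "\<And>t. t \<ge> 0 \<Longrightarrow> (V has_real_derivative V' t) (at t within {0..})"
    and V': "\<And>t. t \<ge> 0 \<Longrightarrow> V' t \<le> - c * V t" and "c > 0"
    and nonneg: "\<And>t. t \<ge> 0 \<Longrightarrow> V t \<ge> 0"
  shows "(V \<longlongrightarrow> 0) at_top"
proof -
  define F where "F t = exp (c * t) * V t" for t
  have F: "(F has_real_derivative exp (c * t) * (c * V t + V' t)) (at t within {0..})" if "t \<ge> 0" for t
    unfolding F_def
    by (rule derivative_eq_intros deriv[OF that] refl | simp add: algebra_simps)+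
  have "F t \<le> F 0" if "t \<ge> 0" for t
  proof (rule DERIV_nonpos_imp_decreasing_open[OF that])
    show "continuous_on {0..t} F"
      by (rule continuous_on_subset[of "{0..}"])
        (auto intro!: DERIV_continuous_on F)
    fix x assume x: "0 < x" "x < t"
    have "at x within {0..} = at x"
      using x by (intro at_within_interior) simp
    then have "(F has_real_derivative exp (c * x) * (c * V x + V' x)) (at x)"
      using F[of x] x by simp
    moreover have "exp (c * x) * (c * V x + V' x) \<le> 0"
      using V'[of x] x by (intro mult_nonneg_nonpos) auto
    ultimately show "\<exists>y. (F has_real_derivative y) (at x) \<and> y \<le> 0" by blast
  qed
  then have le: "V t \<le> V 0 * exp (- (c * t))" if "t \<ge> 0" for t
  proof -
    have "V t = F t * exp (- (c * t))"
      by (simp add: F_def exp_minus)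
    also have "\<dots> \<le> F 0 * exp (- (c * t))"
      using \<open>\<And>t. t \<ge> 0 \<Longrightarrow> F t \<le> F 0\<close>[OF that] by (rule mult_right_mono) simp
    finally show ?thesis by (simp add: F_def)
  qed
  have "filterlim (\<lambda>t. c * t) at_top at_top"
    using filterlim_tendsto_pos_mult_at_top[OF tendsto_const \<open>c > 0\<close> filterlim_ident] .
  then have "filterlim (\<lambda>t. - (c * t)) at_bot at_top"
    by (rule filterlim_compose[OF filterlim_uminus_at_bot_at_top])
  then have "((\<lambda>t. exp (- (c * t))) \<longlongrightarrow> 0) at_top"
    by (rule filterlim_compose[OF exp_at_bot])
  then have bound: "((\<lambda>t. V 0 * exp (- (c * t))) \<longlongrightarrow> 0) at_top"
    by (rule tendsto_mult_right_zero)
  show ?thesis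
  proof (rule tendsto_sandwich[OF _ _ tendsto_const bound])
    show "\<forall>\<^sub>F t in at_top. 0 \<le> V t"
      using eventually_ge_at_top[of 0] by eventually_elim (rule nonneg)
    show "\<forall>\<^sub>F t in at_top. V t \<le> V 0 * exp (- (c * t))"
      using eventually_ge_at_top[of 0] by eventually_elim (rule le)
  qed
qed

section \<open>Network dynamics\<close>

definition combination :: "('n::finite \<Rightarrow> real \<Rightarrow> 'v::real_vector) \<Rightarrow> real^'n \<Rightarrow> real \<Rightarrow> 'v" where
  "combination z \<rho> t = (\<Sum>k\<in>UNIV. \<rho> $ k *\<^sub>R z k t)"

lemma linear_combination: "linear (\<lambda>\<rho>. combination z \<rho> t)"
  by (rule linearI)
    (simp_all add: combination_def scaleR_left_distrib sum.distrib scaleR_sum_right)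

lemma combination_axis_diff:
  "combination z (axis k 1 - axis v 1) t = z k t - z v t"
proof -
  have "combination z (axis i 1) t = z i t" for i
    by (simp add: combination_def axis_def if_distrib[of "\<lambda>c. c *\<^sub>R _"] cong: if_cong)
  then show ?thesis
    by (simp add: linear_diff[OF linear_combination])
qed

lemma matrix_vector_mult_sum_scaleR:
  fixes M :: "real^'n^'m"
  shows "M *v (\<Sum>k\<in>I. c k *\<^sub>R x k) = (\<Sum>k\<in>I. c k *\<^sub>R (M *v x k))"
  by (simp add: linear_sum[OF matrix_vector_mul_linear] matrix_vector_mult_scaleR)

lemma diffusive_coupling_laplacian:
  fixes y :: "'n::finite \<Rightarrow> real^'m"
  assumes "communication_graph E A"
  shows "(\<Sum>j\<in>UNIV. A $ k $ j *\<^sub>R (y j - y k)) = - (\<Sum>j\<in>UNIV. laplacian A $ k $ j *\<^sub>R y j)"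
proof -
  have "(\<Sum>j\<in>UNIV. laplacian A $ k $ j * y j $ i) = (\<Sum>j\<in>UNIV. A $ k $ j * (y k $ i - y j $ i))" for i
    using laplacian_vec_nth[OF assms, of "\<chi> j. y j $ i" k]
    unfolding matrix_vector_mult_def vec_lambda_beta .
  then show ?thesis
    by (simp add: vec_eq_iff right_diff_distrib sum_subtractf)
qed

text \<open>In the coordinates \<open>D\<^sub>g\<^sup>-\<^sup>1 w\<^sub>k\<close> the linear part is multiplied by \<open>g\<close>, and a Lipschitz
  \<open>\<phi>\<close> contributes a term whose Lipschitz constant does not grow with \<open>g\<close>.\<close>

lemma rescaled_network_derivative:
  fixes A :: "real^'n::finite^'n" and \<phi> :: "real^'d::{finite,linorder} \<Rightarrow> real"
  assumes graph: "communication_graph E A" and net: "network_solution \<phi> A K g w"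
    and "g \<noteq> 0" "t \<ge> 0"
  defines "z \<equiv> \<lambda>k t. gain_D (inverse g) *v w k t"
  shows "(z k has_vector_derivative
      g *\<^sub>R (prime_S *v z k t) - g *\<^sub>R (K *v (\<Sum>j\<in>UNIV. laplacian A $ k $ j *\<^sub>R (prime_C *v z j t)))
      + (inverse g ^ CARD('d) * \<phi> (w k t)) *\<^sub>R (prime_B *v vec 1)) (at t within {0..})"
proof -
  define u where "u = (\<Sum>j\<in>UNIV. A $ k $ j *\<^sub>R (prime_C *v w j t - prime_C *v w k t))"
  have "(w k has_vector_derivative drift \<phi> (w k t) + (gain_D g ** K) *v u) (at t within {0..})"
    using net \<open>t \<ge> 0\<close> unfolding network_solution_def u_def by blast
  then have deriv: "(z k has_vector_derivative
      gain_D (inverse g) *v (drift \<phi> (w k t) + (gain_D g ** K) *v u)) (at t within {0..})"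
    unfolding z_def
    by (rule bounded_linear.has_vector_derivative[OF matrix_vector_mul_bounded_linear])
  \<comment> \<open>The factor \<open>g\<close> arises because \<open>prime_C\<close> reads only the
    first coordinate, which the rescaling divides by \<open>g\<close>.\<close>
  have u: "u = (- g) *\<^sub>R (\<Sum>j\<in>UNIV. laplacian A $ k $ j *\<^sub>R (prime_C *v z j t))"
  proof -
    have "prime_C *v w j t = g *\<^sub>R (prime_C *v z j t)" for j
      unfolding z_def by (rule prime_C_gain_D[OF \<open>g \<noteq> 0\<close>])
    then show ?thesis
      unfolding u_def diffusive_coupling_laplacian[OF graph, of k "\<lambda>j. prime_C *v w j t"]
      by (simp add: scaleR_sum_right mult.commute sum_negf)
  qed
  have "gain_D (inverse g) *v ((gain_D g ** K) *v u) = K *v u"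
    using gain_D_inverse[of "inverse g" "K *v u"] \<open>g \<noteq> 0\<close>
    by (simp add: matrix_vector_mul_assoc[symmetric])
  also have "\<dots> = - (g *\<^sub>R (K *v (\<Sum>j\<in>UNIV. laplacian A $ k $ j *\<^sub>R (prime_C *v z j t))))"
    unfolding u matrix_vector_mult_scaleR by simp
  finally have feedback: "gain_D (inverse g) *v ((gain_D g ** K) *v u)
      = - (g *\<^sub>R (K *v (\<Sum>j\<in>UNIV. laplacian A $ k $ j *\<^sub>R (prime_C *v z j t))))" .
  have "vec (\<phi> (w k t)) = \<phi> (w k t) *\<^sub>R (vec 1 :: real^1)"
    by (simp add: vec_eq_iff)
  then have "gain_D (inverse g) *v drift \<phi> (w k t) = g *\<^sub>R (prime_S *v z k t)
      + (inverse g ^ CARD('d) * \<phi> (w k t)) *\<^sub>R (prime_B *v vec 1)"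
    unfolding drift_def z_def
    by (simp add: matrix_vector_right_distrib gain_D_prime_S[OF \<open>g \<noteq> 0\<close>] gain_D_prime_B
        matrix_vector_mult_scaleR)
  then show ?thesis
    using deriv unfolding matrix_vector_right_distrib feedback by (simp add: algebra_simps)
qed

text \<open>The same matrices act on every node, so weighting commutes with them, and the coupling
  only replaces \<rho> by \<rho> L. The left action of L on weights thus governs the coupled linear
  dynamics.\<close>

lemma combination_derivative:
  fixes A :: "real^'n::finite^'n" and \<phi> :: "real^'d::{finite,linorder} \<Rightarrow> real"
  assumes graph: "communication_graph E A" and net: "network_solution \<phi> A K g w"
    and "g \<noteq> 0" "t \<ge> 0"
  defines "z \<equiv> \<lambda>k t. gain_D (inverse g) *v w k t"
  shows "(combination z \<rho> has_vector_derivative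
      g *\<^sub>R (prime_S *v combination z \<rho> t)
      - g *\<^sub>R (K *v (prime_C *v combination z (\<rho> v* laplacian A) t))
      + (inverse g ^ CARD('d) * (\<Sum>k\<in>UNIV. \<rho> $ k * \<phi> (w k t))) *\<^sub>R (prime_B *v vec 1))
      (at t within {0..})"
proof -
  let ?b = "prime_B *v vec 1 :: real^'d::{finite,linorder}"
  define s where "s k = (\<Sum>j\<in>UNIV. laplacian A $ k $ j *\<^sub>R (prime_C *v z j t))" for k
  have "combination z \<rho> = (\<lambda>t. \<Sum>k\<in>UNIV. \<rho> $ k *\<^sub>R z k t)"
    by (simp add: combination_def fun_eq_iff)
  moreover have "((\<lambda>t. \<Sum>k\<in>UNIV. \<rho> $ k *\<^sub>R z k t) has_vector_derivative
      (\<Sum>k\<in>UNIV. \<rho> $ k *\<^sub>R (g *\<^sub>R (prime_S *v z k t) - g *\<^sub>R (K *v s k)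
        + (inverse g ^ CARD('d) * \<phi> (w k t)) *\<^sub>R ?b))) (at t within {0..})"
    unfolding s_def z_def
    by (intro has_vector_derivative_sum bounded_linear.has_vector_derivative[OF bounded_linear_scaleR_right]
        rescaled_network_derivative[OF graph net] assms)
  moreover have KC: "K *v (prime_C *v combination z (\<rho> v* laplacian A) t)
      = (\<Sum>k\<in>UNIV. \<rho> $ k *\<^sub>R (K *v s k))"
  proof -
    have "prime_C *v combination z (\<rho> v* laplacian A) t
        = (\<Sum>j\<in>UNIV. \<Sum>k\<in>UNIV. (laplacian A $ k $ j * \<rho> $ k) *\<^sub>R (prime_C *v z j t))"
      unfolding combination_def matrix_vector_mult_sum_scaleR
      by (simp add: vector_matrix_mult_def scaleR_sum_left mult.commute)
    also have "\<dots> = (\<Sum>k\<in>UNIV. \<rho> $ k *\<^sub>R s k)"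
      unfolding s_def scaleR_sum_right by (subst sum.swap) (simp add: mult.commute)
    finally show ?thesis by (simp only: matrix_vector_mult_sum_scaleR)
  qed
  ultimately show ?thesis
    unfolding KC unfolding combination_def matrix_vector_mult_sum_scaleR
    by (simp add: scaleR_right_distrib scaleR_right_diff_distrib sum.distrib sum_subtractf
        scaleR_sum_right scaleR_sum_left sum_distrib_left mult.left_commute mult.commute)
qed

text \<open>The scalar balance behind the decay, where \<open>x i\<close> stands for the norm of the
  inverse of \<open>P\<close> applied to y_i, \<open>c i\<close> and \<open>c' i\<close> for the
  outputs belonging to \<rho>_i and \<rho>_i L, and \<open>n i\<close> for the nonlinear term. With
  X the sum of squares of the \<open>x i\<close>, one half of g a X absorbs the spectral slack
  \<epsilon>; the other half absorbs the nonlinearity and leaves - X.\<close>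

lemma lyapunov_derivative_estimate:
  fixes x c c' n :: "'i \<Rightarrow> real"
  assumes "finite I" "g \<ge> 0" "\<epsilon> \<ge> 0" "h \<ge> 0"
    and coupling: "(\<mu> - \<epsilon>) * (\<Sum>i\<in>I. (c i)\<^sup>2) \<le> (\<Sum>i\<in>I. c i * c' i)"
    and c: "\<And>i. i \<in> I \<Longrightarrow> \<bar>c i\<bar> \<le> \<kappa> * x i" and \<epsilon>: "4 * \<epsilon> * \<kappa>\<^sup>2 \<le> a"
    and n: "\<And>i. i \<in> I \<Longrightarrow> n i \<le> h * x i * (\<Sum>j\<in>I. x j)"
    and g: "2 * (2 * h * card I + 1) \<le> g * a"
  shows "(\<Sum>i\<in>I. g * (2 * \<mu> * (c i)\<^sup>2 - a * (x i)\<^sup>2) - 2 * g * (c i * c' i) + 2 * n i) \<le> - (\<Sum>i\<in>I. (x i)\<^sup>2)"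
proof -
  define X where "X = (\<Sum>i\<in>I. (x i)\<^sup>2)"
  define C where "C = (\<Sum>i\<in>I. (c i)\<^sup>2)"
  have "X \<ge> 0" unfolding X_def by (rule sum_nonneg) simp
  have "C \<le> \<kappa>\<^sup>2 * X"
    unfolding C_def X_def sum_distrib_left
    using c by (intro sum_mono) (metis abs_le_square_iff abs_of_nonneg abs_ge_zero order_trans power_mult_distrib)
  then have "g * (4 * \<epsilon> * C) \<le> g * (4 * \<epsilon> * (\<kappa>\<^sup>2 * X))"
    using assms(2,3) by (intro mult_left_mono) auto
  also have "\<dots> = g * X * (4 * \<epsilon> * \<kappa>\<^sup>2)" by simp
  also have "\<dots> \<le> g * X * a"
    using \<epsilon> \<open>X \<ge> 0\<close> assms(2) by (intro mult_left_mono) auto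
  finally have *: "4 * (g * \<epsilon> * C) \<le> g * a * X" by (simp add: mult_ac)
  have "(\<Sum>i\<in>I. n i) \<le> (\<Sum>i\<in>I. h * x i * (\<Sum>j\<in>I. x j))"
    by (rule sum_mono) (rule n)
  also have "\<dots> = h * (\<Sum>i\<in>I. x i)\<^sup>2"
    by (simp only: sum_distrib_left[symmetric] sum_distrib_right[symmetric] power2_eq_square mult.assoc)
  also have "\<dots> \<le> h * (X * card I)"
    unfolding X_def using \<open>h \<ge> 0\<close> by (intro mult_left_mono sum_squared_le_sum_of_squares)
  finally have n_le: "(\<Sum>i\<in>I. n i) \<le> h * card I * X" by (simp add: mult_ac)
  have "2 * (2 * h * card I + 1) * X \<le> g * a * X"
    using g \<open>X \<ge> 0\<close> by (rule mult_right_mono)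
  then have g_le: "4 * (h * card I * X) + 2 * X \<le> g * a * X" by (simp add: algebra_simps)
  have "(\<Sum>i\<in>I. g * (2 * \<mu> * (c i)\<^sup>2 - a * (x i)\<^sup>2) - 2 * g * (c i * c' i) + 2 * n i)
      = 2 * (g * \<mu> * C) - g * a * X - 2 * (g * (\<Sum>i\<in>I. c i * c' i)) + 2 * (\<Sum>i\<in>I. n i)"
    unfolding X_def C_def
    by (simp add: sum.distrib sum_subtractf sum_distrib_left sum_distrib_right right_diff_distrib mult_ac)
  moreover have "g * ((\<mu> - \<epsilon>) * C) \<le> g * (\<Sum>i\<in>I. c i * c' i)"
    using coupling assms(2) unfolding C_def by (intro mult_left_mono)
  moreover have "g * ((\<mu> - \<epsilon>) * C) = g * \<mu> * C - g * \<epsilon> * C"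
    by (simp add: algebra_simps)
  ultimately show ?thesis
    using * n_le g_le unfolding X_def[symmetric] by linarith
qed

lemma quadratic_form_derivative:
  fixes R :: "real^'d::finite^'d"
  assumes sym: "\<And>x y. (R *v x) \<bullet> y = x \<bullet> (R *v y)"
    and y: "(y has_vector_derivative y') (at t within T)"
  shows "((\<lambda>t. y t \<bullet> (R *v y t)) has_real_derivative 2 * ((R *v y t) \<bullet> y')) (at t within T)"
proof -
  have "((\<lambda>t. y t \<bullet> (R *v y t)) has_vector_derivative y t \<bullet> (R *v y') + y' \<bullet> (R *v y t)) (at t within T)"
    by (intro bounded_bilinear.has_vector_derivative[OF bounded_bilinear_inner] y
        bounded_linear.has_vector_derivative[OF matrix_vector_mul_bounded_linear])
  then show ?thesis
    unfolding has_real_derivative_iff_has_vector_derivative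
    by (simp add: sym[of "y t" y'] inner_commute[of y' "R *v y t"])
qed

text \<open>As the weights sum to zero, the value of \<phi> at node \<open>v\<close> may be
  subtracted throughout. The Lipschitz estimate then costs at most g^d, d being
  \<open>CARD('d)\<close>, which the prefactor cancels.\<close>

lemma nonlinearity_bound:
  fixes A :: "real^'n::finite^'n" and \<phi> :: "real^'d::{finite,linorder} \<Rightarrow> real"
  assumes lip: "l-lipschitz_on UNIV \<phi>" and "g \<ge> 1" and zero_sum: "(\<Sum>k\<in>UNIV. \<rho> $ k) = 0"
    and dist: "\<And>k. norm (z k - z v) \<le> \<delta>"
  shows "\<bar>inverse g ^ CARD('d) * (\<Sum>k\<in>UNIV. \<rho> $ k * \<phi> (gain_D g *v z k))\<bar>
    \<le> (\<Sum>k\<in>UNIV. \<bar>\<rho> $ k\<bar>) * (l * \<delta>)"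
proof -
  have "l \<ge> 0" using lip by (rule lipschitz_on_nonneg)
  have pos: "g ^ CARD('d) > 0" using \<open>g \<ge> 1\<close> by simp
  have "\<bar>\<phi> (gain_D g *v z k) - \<phi> (gain_D g *v z v)\<bar> \<le> g ^ CARD('d) * (l * \<delta>)" for k
  proof -
    have "\<bar>\<phi> (gain_D g *v z k) - \<phi> (gain_D g *v z v)\<bar> \<le> l * norm (gain_D g *v z k - gain_D g *v z v)"
      using lipschitz_onD[OF lip, of "gain_D g *v z k" "gain_D g *v z v"] by (simp add: dist_norm)
    also have "\<dots> = l * norm (gain_D g *v (z k - z v))"
      by (simp only: matrix_vector_mult_diff_distrib)
    also have "\<dots> \<le> l * (g ^ CARD('d) * norm (z k - z v))"
      using \<open>l \<ge> 0\<close> by (intro mult_left_mono norm_gain_D_le \<open>g \<ge> 1\<close>)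
    also have "\<dots> \<le> l * (g ^ CARD('d) * \<delta>)"
      using \<open>l \<ge> 0\<close> pos by (intro mult_left_mono dist) auto
    finally show ?thesis by (simp add: mult.left_commute)
  qed
  then have "\<bar>\<rho> $ k * (\<phi> (gain_D g *v z k) - \<phi> (gain_D g *v z v))\<bar> \<le> \<bar>\<rho> $ k\<bar> * (g ^ CARD('d) * (l * \<delta>))" for k
    unfolding abs_mult by (intro mult_left_mono) auto
  then have "\<bar>\<Sum>k\<in>UNIV. \<rho> $ k * (\<phi> (gain_D g *v z k) - \<phi> (gain_D g *v z v))\<bar>
      \<le> (\<Sum>k\<in>UNIV. \<bar>\<rho> $ k\<bar> * (g ^ CARD('d) * (l * \<delta>)))"
    by (intro sum_abs[THEN order_trans] sum_mono)
  also have "(\<Sum>k\<in>UNIV. \<rho> $ k * (\<phi> (gain_D g *v z k) - \<phi> (gain_D g *v z v)))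
      = (\<Sum>k\<in>UNIV. \<rho> $ k * \<phi> (gain_D g *v z k))"
    by (simp add: right_diff_distrib sum_subtractf zero_sum flip: sum_distrib_right)
  finally have "\<bar>\<Sum>k\<in>UNIV. \<rho> $ k * \<phi> (gain_D g *v z k)\<bar>
      \<le> g ^ CARD('d) * ((\<Sum>k\<in>UNIV. \<bar>\<rho> $ k\<bar>) * (l * \<delta>))"
    by (simp only: sum_distrib_right[symmetric] mult.left_commute[of "sum _ _"])
  then have "\<bar>\<Sum>k\<in>UNIV. \<rho> $ k * \<phi> (gain_D g *v z k)\<bar> / g ^ CARD('d)
      \<le> (\<Sum>k\<in>UNIV. \<bar>\<rho> $ k\<bar>) * (l * \<delta>)"
    unfolding pos_divide_le_eq[OF pos] by (simp only: mult.commute)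
  moreover have "\<bar>inverse g ^ CARD('d)\<bar> = inverse (g ^ CARD('d))"
    using \<open>g \<ge> 1\<close> by (simp add: power_inverse)
  ultimately show ?thesis
    by (simp only: abs_mult divide_inverse mult.commute)
qed

lemma matrix_norm_bound:
  fixes M :: "real^'n^'m"
  obtains K where "K > 0" "\<And>x. norm (M *v x) \<le> K * norm x"
proof -
  obtain K where "K > 0" "\<forall>x. norm (M *v x) \<le> norm x * K"
    using bounded_linear.pos_bounded[OF matrix_vector_mul_bounded_linear[of M]] by blast
  then show thesis
    using that[of K] by (simp add: mult.commute)
qed

section \<open>Choice of the gain and convergence to the root\<close>

theorem corollary1:
  fixes E :: "('n::finite \<times> 'n) set"
    and A :: "real^'n^'n"
    and \<phi> :: "real^'d::{finite,linorder} \<Rightarrow> real"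
    and \<mu> a :: real
    and P :: "real^'d::{finite,linorder}^'d::{finite,linorder}"
    and K\<^sub>0 :: "real^1^'d::{finite,linorder}"
  assumes graph: "communication_graph E A"
    and lipschitz: "\<exists>l. l-lipschitz_on UNIV \<phi>"
    and connected: "graph_connected E"
    and iss: "\<exists>W. W \<noteq> {} \<and> compact W \<and> invariant_set \<phi> W \<and> ISS_relative_to \<phi> W"
    and mu: "\<mu> > 0" "\<forall>z \<in># other_eigenvalues (laplacian A). Re z \<ge> \<mu>"
    and a: "a > 0"
    and P: "sym_pos_def P" "riccati_solution \<mu> a P"
    and K0: "K\<^sub>0 = P ** transpose prime_C"
  shows "\<exists>g_star>0. \<forall>g\<ge>g_star. \<forall>w0 w.
           network_solution \<phi> A K\<^sub>0 g w \<and> (\<forall>k. w k 0 = w0 k) \<longrightarrow>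
           (\<exists>w_star :: real \<Rightarrow> real^'d::{finite,linorder}.
              \<forall>k. ((\<lambda>t. norm (w k t - w_star t)) \<longlongrightarrow> 0) at_top)"
proof -
  obtain v where root: "\<And>k. (k, v) \<in> E\<^sup>*"
    using connected graph_path_rtrancl unfolding graph_connected_def by (metis rtrancl.rtrancl_refl)
  obtain l where l: "l-lipschitz_on UNIV \<phi>" using lipschitz by blast
  have "l \<ge> 0" using l by (rule lipschitz_on_nonneg)
  obtain R where PR: "\<And>x. P *v (R *v x) = x" and R: "\<And>x y. (R *v x) \<bullet> y = x \<bullet> (R *v y)"
    using sym_pos_def_inverse[OF P(1)] by blast
  obtain \<delta> where \<delta>: "\<delta> > 0" "\<And>x. \<delta> * (x \<bullet> x) \<le> x \<bullet> (P *v x)"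
    using sym_pos_def_coercive[OF P(1)] by blast
  obtain p where p: "p > 0" "\<And>x. norm (P *v x) \<le> p * norm x"
    using matrix_norm_bound[of P] by blast
  obtain \<kappa> where \<kappa>: "\<kappa> > 0" "\<And>x. norm ((prime_C ** P) *v x) \<le> \<kappa> * norm x"
    using matrix_norm_bound[of "prime_C ** P"] by blast
  \<comment> \<open>Since |C y| is at most \<kappa> times the norm of R y, this slack costs at most
    half of the Riccati damping.\<close>
  define \<epsilon> where "\<epsilon> = a / (4 * \<kappa>\<^sup>2)"
  have \<epsilon>: "\<epsilon> > 0" "4 * \<epsilon> * \<kappa>\<^sup>2 \<le> a"
    using a \<kappa>(1) by (simp_all add: \<epsilon>_def)
  obtain I :: "((complex^'n) \<times> bool) set" and \<rho> s where fin: "finite I"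
    and zero_sum: "\<And>i. i \<in> I \<Longrightarrow> (\<Sum>k\<in>UNIV. \<rho> i $ k) = 0"
    and s: "\<And>k. axis k 1 - axis v 1 = (\<Sum>i\<in>I. s k i *\<^sub>R \<rho> i)"
    and coupling: "\<And>c. linear c \<Longrightarrow>
      (\<mu> - \<epsilon>) * (\<Sum>i\<in>I. (c (\<rho> i))\<^sup>2) \<le> (\<Sum>i\<in>I. c (\<rho> i) * c (\<rho> i v* laplacian A))"
    using laplacian_lyapunov_family[OF graph root mu(2) \<epsilon>(1)] by blast
  define b where "b = (prime_B *v vec 1 :: real^'d::{finite,linorder})"
  define m where "m = (\<Sum>k\<in>UNIV. \<Sum>i\<in>I. \<bar>s k i\<bar>)"
  define r where "r = (\<Sum>i\<in>I. \<Sum>k\<in>UNIV. \<bar>\<rho> i $ k\<bar>)"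
  \<comment> \<open>\<open>r\<close> bounds the weights, \<open>l\<close> is the Lipschitz constant,
    \<open>m * p\<close> leads from the norms of the R y_i to the differences of the rescaled
    states, and \<open>b\<close> is the input direction. No factor depends on the gain.\<close>
  define h where "h = r * (l * (m * p)) * norm b"
  have "m \<ge> 0" "r \<ge> 0" unfolding m_def r_def by (simp_all add: sum_nonneg)
  have "h \<ge> 0"
    unfolding h_def using \<open>m \<ge> 0\<close> \<open>r \<ge> 0\<close> \<open>l \<ge> 0\<close> p(1) by simp
  \<comment> \<open>The 1 makes g^d the largest entry of the scaling; the quotient is the threshold
    of \<open>lyapunov_derivative_estimate\<close>.\<close>
  define g_star where "g_star = max 1 (2 * (2 * h * card I + 1) / a)"
  have "\<exists>w_star :: real \<Rightarrow> real^'d::{finite,linorder}. \<forall>k. ((\<lambda>t. norm (w k t - w_star t)) \<longlongrightarrow> 0) at_top"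
    if g: "g \<ge> g_star" and net: "network_solution \<phi> A K\<^sub>0 g w" for g w
  proof -
    have "g \<ge> 1" using g by (simp add: g_star_def)
    then have "g \<noteq> 0" "g \<ge> 0" by auto
    have ga: "2 * (2 * h * card I + 1) \<le> g * a"
      using g a by (simp add: g_star_def divide_le_eq)
    define z where "z k t = gain_D (inverse g) *v w k t" for k t
    have w_z: "w k t = gain_D g *v z k t" for k t
      unfolding z_def by (rule gain_D_inverse[OF \<open>g \<noteq> 0\<close>, symmetric])
    define y where "y i = combination z (\<rho> i)" for i
    define x where "x t i = norm (R *v y i t)" for t i
    define c where "c t q = (prime_C *v combination z q t) $ 1" for t q
    define \<Phi> where "\<Phi> t i = inverse g ^ CARD('d) * (\<Sum>k\<in>UNIV. \<rho> i $ k * \<phi> (w k t))" for t i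
    have y_le: "norm (y i t) \<le> p * x t i" for i t
      using p(2)[of "R *v y i t"] by (simp add: PR x_def)
    \<comment> \<open>Differences to the root are combinations with weights e_k - e_v, which the
      \<rho>_i span; controlling all y_i therefore controls them.\<close>
    have diff: "z k t - z v t = (\<Sum>i\<in>I. s k i *\<^sub>R y i t)" for k t
    proof -
      have "z k t - z v t = combination z (axis k 1 - axis v 1) t"
        by (rule combination_axis_diff[symmetric])
      also have "\<dots> = (\<Sum>i\<in>I. s k i *\<^sub>R y i t)"
        unfolding s y_def
        by (simp only: linear_sum[OF linear_combination] linear_scale[OF linear_combination])
      finally show ?thesis .
    qed
    have diff_le: "norm (z k t - z v t) \<le> m * p * (\<Sum>i\<in>I. x t i)" for k t
    proof -
      have "norm (s k i *\<^sub>R y i t) \<le> m * (p * x t i)" if "i \<in> I" for i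
      proof -
        have "\<bar>s k i\<bar> \<le> (\<Sum>i\<in>I. \<bar>s k i\<bar>)"
          using that fin by (intro member_le_sum[of i I "\<lambda>i. \<bar>s k i\<bar>"]) auto
        also have "\<dots> \<le> m"
          unfolding m_def by (intro member_le_sum[of k UNIV "\<lambda>k. \<Sum>i\<in>I. \<bar>s k i\<bar>"]) (auto intro: sum_nonneg)
        finally show ?thesis
          using y_le[of i t] by (simp add: mult_mono)
      qed
      then have "norm (\<Sum>i\<in>I. s k i *\<^sub>R y i t) \<le> (\<Sum>i\<in>I. m * (p * x t i))"
        by (rule sum_norm_le)
      then show ?thesis
        unfolding diff by (simp add: sum_distrib_left mult.assoc)
    qed
    have noise: "\<Phi> t i * ((R *v y i t) \<bullet> b) \<le> h * x t i * (\<Sum>j\<in>I. x t j)" if "i \<in> I" for t i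
    proof -
      have "\<bar>\<Phi> t i\<bar> \<le> (\<Sum>k\<in>UNIV. \<bar>\<rho> i $ k\<bar>) * (l * (m * p * (\<Sum>j\<in>I. x t j)))"
        unfolding \<Phi>_def w_z
        by (rule nonlinearity_bound[where z = "\<lambda>k. z k t" and v = v, OF l \<open>g \<ge> 1\<close> zero_sum[OF that] diff_le])
      also have "\<dots> \<le> r * (l * (m * p * (\<Sum>j\<in>I. x t j)))"
      proof (rule mult_right_mono)
        show "(\<Sum>k\<in>UNIV. \<bar>\<rho> i $ k\<bar>) \<le> r"
          unfolding r_def using that fin
          by (intro member_le_sum[of i I "\<lambda>i. \<Sum>k\<in>UNIV. \<bar>\<rho> i $ k\<bar>"]) (auto intro: sum_nonneg)
        show "0 \<le> l * (m * p * (\<Sum>j\<in>I. x t j))"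
          using \<open>l \<ge> 0\<close> \<open>m \<ge> 0\<close> p(1) by (simp add: x_def sum_nonneg)
      qed
      finally have \<Phi>_le: "\<bar>\<Phi> t i\<bar> \<le> r * (l * (m * p * (\<Sum>j\<in>I. x t j)))" .
      have "\<Phi> t i * ((R *v y i t) \<bullet> b) \<le> \<bar>\<Phi> t i\<bar> * \<bar>(R *v y i t) \<bullet> b\<bar>"
        by (metis abs_ge_self abs_mult)
      also have "\<dots> \<le> (r * (l * (m * p * (\<Sum>j\<in>I. x t j)))) * (x t i * norm b)"
        unfolding x_def
        by (intro mult_mono \<Phi>_le[unfolded x_def] Cauchy_Schwarz_ineq2 order_trans[OF abs_ge_zero \<Phi>_le[unfolded x_def]] abs_ge_zero)
      also have "\<dots> = h * x t i * (\<Sum>j\<in>I. x t j)"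
        by (simp add: h_def mult_ac)
      finally show ?thesis .
    qed
    define V where "V t = (\<Sum>i\<in>I. y i t \<bullet> (R *v y i t))" for t
    \<comment> \<open>The summands come from the drift through the Riccati equation, from the
      coupling, and from the nonlinearity.\<close>
    define V' where "V' t = (\<Sum>i\<in>I. g * (2 * \<mu> * (c t (\<rho> i))\<^sup>2 - a * (x t i)\<^sup>2)
      - 2 * g * (c t (\<rho> i) * c t (\<rho> i v* laplacian A)) + 2 * (\<Phi> t i * ((R *v y i t) \<bullet> b)))" for t
    have deriv: "(V has_real_derivative V' t) (at t within {0..})" if "t \<ge> 0" for t
    proof -
      have "((\<lambda>t. y i t \<bullet> (R *v y i t)) has_real_derivative
          g * (2 * \<mu> * (c t (\<rho> i))\<^sup>2 - a * (x t i)\<^sup>2)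
          - 2 * g * (c t (\<rho> i) * c t (\<rho> i v* laplacian A)) + 2 * (\<Phi> t i * ((R *v y i t) \<bullet> b)))
          (at t within {0..})" for i
      proof -
        let ?u = "R *v y i t"
        let ?s = "prime_C *v combination z (\<rho> i v* laplacian A) t"
        have y': "(y i has_vector_derivative g *\<^sub>R (prime_S *v y i t) - g *\<^sub>R (K\<^sub>0 *v ?s) + \<Phi> t i *\<^sub>R b)
            (at t within {0..})"
          using combination_derivative[OF graph net \<open>g \<noteq> 0\<close> that, of "\<rho> i"]
          unfolding y_def \<Phi>_def b_def z_def[abs_def] .
        have S: "2 * (?u \<bullet> (prime_S *v y i t)) = 2 * \<mu> * (c t (\<rho> i))\<^sup>2 - a * (x t i)\<^sup>2"
          using riccati_quadratic_form[OF P, of ?u]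
          by (simp add: PR c_def x_def y_def power2_norm_eq_inner)
        \<comment> \<open>The choice of \<open>K\<^sub>0\<close> lets \<open>P\<close> cancel its
          inverse, so the feedback contributes a mere product of outputs, matching the quadratic
          output term of the Riccati equation.\<close>
        have "?u \<bullet> (K\<^sub>0 *v ?s) = (P *v ?u) \<bullet> (transpose prime_C *v ?s)"
          unfolding K0 matrix_vector_mul_assoc[symmetric] by (rule sym_pos_def_inner_commute[OF P(1)])
        also have "\<dots> = (prime_C *v y i t) \<bullet> ?s"
          unfolding PR by (rule inner_transpose)
        also have "\<dots> = c t (\<rho> i) * c t (\<rho> i v* laplacian A)"
          by (simp add: inner_vec_def c_def y_def)
        finally have K: "?u \<bullet> (K\<^sub>0 *v ?s) = c t (\<rho> i) * c t (\<rho> i v* laplacian A)" .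
        have "2 * (?u \<bullet> (g *\<^sub>R (prime_S *v y i t) - g *\<^sub>R (K\<^sub>0 *v ?s) + \<Phi> t i *\<^sub>R b))
            = g * (2 * (?u \<bullet> (prime_S *v y i t))) - 2 * g * (?u \<bullet> (K\<^sub>0 *v ?s)) + 2 * (\<Phi> t i * (?u \<bullet> b))"
          by (simp add: inner_add_right inner_diff_right algebra_simps)
        then show ?thesis
          using quadratic_form_derivative[of R, OF R y'] unfolding S K by simp
      qed
      then show ?thesis
        unfolding V_def[abs_def] V'_def by (rule DERIV_sum)
    qed
    have V'_le: "V' t \<le> - (\<Sum>i\<in>I. (x t i)\<^sup>2)" for t
      unfolding V'_def
    proof (rule lyapunov_derivative_estimate[OF fin \<open>g \<ge> 0\<close> _ \<open>h \<ge> 0\<close> _ _ \<epsilon>(2) noise ga])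
      show "0 \<le> \<epsilon>" using \<epsilon>(1) by simp
      have "linear (c t)"
        unfolding c_def[abs_def]
        by (rule linearI)
          (simp_all add: linear_add[OF linear_combination] linear_scale[OF linear_combination]
            matrix_vector_right_distrib matrix_vector_mult_scaleR)
      then show "(\<mu> - \<epsilon>) * (\<Sum>i\<in>I. (c t (\<rho> i))\<^sup>2) \<le> (\<Sum>i\<in>I. c t (\<rho> i) * c t (\<rho> i v* laplacian A))"
        by (rule coupling)
      show "\<bar>c t (\<rho> i)\<bar> \<le> \<kappa> * x t i" for i
      proof -
        have "\<bar>c t (\<rho> i)\<bar> \<le> norm (prime_C *v y i t)"
          unfolding c_def y_def by (rule component_le_norm_cart)
        also have "\<dots> \<le> \<kappa> * x t i"
          using \<kappa>(2)[of "R *v y i t"] by (simp add: PR x_def flip: matrix_vector_mul_assoc)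
        finally show ?thesis .
      qed
    qed
    have V_le: "V t \<le> p * (\<Sum>i\<in>I. (x t i)\<^sup>2)" for t
    proof -
      have "y i t \<bullet> (R *v y i t) \<le> p * (x t i)\<^sup>2" for i
      proof -
        have "y i t \<bullet> (R *v y i t) \<le> norm (y i t) * x t i"
          unfolding x_def by (rule norm_cauchy_schwarz)
        also have "\<dots> \<le> p * x t i * x t i"
          by (intro mult_right_mono y_le) (simp add: x_def)
        finally show ?thesis by (simp add: power2_eq_square mult.assoc)
      qed
      then show ?thesis unfolding V_def sum_distrib_left by (intro sum_mono)
    qed
    \<comment> \<open>Coercivity of \<open>P\<close> is used at R y, where the form of
      \<open>P\<close> takes the value of the form of \<open>R\<close> at y.\<close>
    have V_ge: "\<delta> * (x t i)\<^sup>2 \<le> y i t \<bullet> (R *v y i t)" for t i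
      using \<delta>(2)[of "R *v y i t"] by (simp add: PR x_def power2_norm_eq_inner inner_commute)
    have nonneg: "0 \<le> y i t \<bullet> (R *v y i t)" for t i
      using \<delta>(1) by (intro order_trans[OF _ V_ge]) simp
    have "(V \<longlongrightarrow> 0) at_top"
    proof (rule exponential_decay_tendsto_zero[OF deriv])
      \<comment> \<open>\<open>V_le\<close> bounds V by \<open>p\<close> times the sum of squares
        that \<open>V'_le\<close> provides as damping, hence the rate 1 / p.\<close>
      show "V' t \<le> - (1 / p) * V t" for t
      proof -
        have "V t / p \<le> (\<Sum>i\<in>I. (x t i)\<^sup>2)"
          using V_le[of t] p(1) by (simp add: divide_le_eq mult.commute)
        then show ?thesis using V'_le[of t] by simp
      qed
      show "V t \<ge> 0" for t unfolding V_def by (rule sum_nonneg) (rule nonneg)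
    qed (use p(1) in simp_all)
    then have V0: "((\<lambda>t. V t / \<delta>) \<longlongrightarrow> 0) at_top"
      by (rule tendsto_divide_zero)
    have "((\<lambda>t. x t i) \<longlongrightarrow> 0) at_top" if "i \<in> I" for i
    proof -
      have "(x t i)\<^sup>2 \<le> V t / \<delta>" for t
      proof -
        have "y i t \<bullet> (R *v y i t) \<le> V t"
          unfolding V_def using that fin nonneg
          by (intro member_le_sum[of i I "\<lambda>i. y i t \<bullet> (R *v y i t)"])
        then show ?thesis
          using V_ge[of t i] \<delta>(1) by (simp add: le_divide_eq mult.commute)
      qed
      then have "((\<lambda>t. (x t i)\<^sup>2) \<longlongrightarrow> 0) at_top"
        by (intro tendsto_sandwich[OF _ _ tendsto_const V0] always_eventually) auto
      then show ?thesis by simp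
    qed
    then have lim: "((\<lambda>t. g ^ CARD('d) * (m * p * (\<Sum>i\<in>I. x t i))) \<longlongrightarrow> 0) at_top"
      by (intro tendsto_mult_right_zero tendsto_null_sum)
    have bound: "norm (w k t - w v t) \<le> g ^ CARD('d) * (m * p * (\<Sum>i\<in>I. x t i))" for k t
    proof -
      have "norm (w k t - w v t) \<le> g ^ CARD('d) * norm (z k t - z v t)"
        using norm_gain_D_le[OF \<open>g \<ge> 1\<close>, of "z k t - z v t"]
        unfolding matrix_vector_mult_diff_distrib w_z .
      also have "\<dots> \<le> g ^ CARD('d) * (m * p * (\<Sum>i\<in>I. x t i))"
        using \<open>g \<ge> 0\<close> by (intro mult_left_mono diff_le) simp
      finally show ?thesis .
    qed
    have "((\<lambda>t. norm (w k t - w v t)) \<longlongrightarrow> 0) at_top" for k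
    proof (rule Lim_null_comparison[OF _ lim])
      show "\<forall>\<^sub>F t in at_top. norm (norm (w k t - w v t)) \<le> g ^ CARD('d) * (m * p * (\<Sum>i\<in>I. x t i))"
        by (intro always_eventually allI) (simp only: real_norm_def abs_norm_cancel bound)
    qed
    \<comment> \<open>The trajectory of the root \<open>v\<close> is the common limit
      motion.\<close>
    then show ?thesis by blast
  qed
  moreover have "g_star > 0" by (simp add: g_star_def)
  ultimately show ?thesis by blast
qed

end
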